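(* Let $\mathbb{F}$ be a field, let $\beta^{m,n}_d=\dim_{\mathbb{F}}\tilde{H}_d(\mathsf{M}_{m,n};\mathbb{F})$, and define $\hat\beta^{a,b}_k=\beta^{m,n}_d$ where $m=k+a+3b-1$, $n=k+2a+3b-1$, $d=k+a+2b-2$. For each integer $k\ge0$ there is a polynomial $f_k(a,b)$ of degree $3k$ such that $\hat\beta^{a,b}_k\le f_k(a,b)$ whenever $a\ge0$ and $b\ge k+2$, and such that \[ f_k(a,b)=\frac{1}{3^k k!}\bigl((a+3b)^3-9b^3\bigr)^k+\epsilon_k(a,b) \] for some polynomial $\epsilon_k(a,b)$ of degree at most $3k-1$. Equivalently, $\beta^{m,n}_d\le f_{3d-m-n+4}(n-m,m-d-1)$ whenever $m\le n\le 2m-5$ and $\frac{m+n-4}{3}\le d\le\frac{2m+n-7}{4}$.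
   Context: $\mathsf{M}_{m,n}$ denotes the chessboard complex: the simplicial complex whose faces are the matchings (sets of pairwise vertex-disjoint edges) in the complete bipartite graph $K_{m,n}$. $\tilde H$ denotes reduced simplicial homology. *)

theory Defs
  imports
    "Jordan_Normal_Form.VS_Connect"
    "HOL-Algebra.AbelCoset"
    "HOL-Computational_Algebra.Polynomial"
begin

text \<open>
  A simplicial complex is given by its set \<open>K\<close> of faces, assumed finite here and including the
  empty face, which has dimension \<open>-1\<close>; this face makes the homology below the reduced one.
  A \<open>d\<close>-chain is a function on all vertex sets that vanishes off the \<open>d\<close>-faces of \<open>K\<close>.
\<close>

definition chain_space :: "'v set set \<Rightarrow> int \<Rightarrow> ('f::field, 'v set \<Rightarrow> 'f) module" where
  "chain_space K d =
    \<lparr>carrier = {c. \<forall>\<sigma>. c \<sigma> \<noteq> 0 \<longrightarrow> \<sigma> \<in> K \<and> int (card \<sigma>) = d + 1},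
     mult = undefined, one = undefined,
     zero = (\<lambda>_. 0),
     add = (\<lambda>c c' \<sigma>. c \<sigma> + c' \<sigma>),
     smult = (\<lambda>a c \<sigma>. a * c \<sigma>)\<rparr>"

text \<open>
  Here \<open>r\<close> is a strict linear order on the vertices, orienting the faces: if
  \<open>\<sigma> = {v\<^sub>0, \<dots>, v\<^sub>d}\<close> is listed increasingly, then \<open>\<partial>\<sigma> = (\<Sum>i\<le>d. (-1)^i (\<sigma> - {v\<^sub>i}))\<close>,
  and \<open>i\<close> is the number of vertices of \<open>\<sigma>\<close> below \<open>v\<^sub>i\<close>.
\<close>

definition boundary_map ::
  "('v \<times> 'v) set \<Rightarrow> 'v set set \<Rightarrow> ('v set \<Rightarrow> 'f::field) \<Rightarrow> 'v set \<Rightarrow> 'f" where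
  "boundary_map r K c \<tau> =
    (\<Sum>\<sigma>\<in>K. \<Sum>v | v \<in> \<sigma> \<and> \<sigma> - {v} = \<tau>. (-1) ^ card {u \<in> \<sigma>. (u, v) \<in> r} * c \<sigma>)"

definition cycles :: "('v \<times> 'v) set \<Rightarrow> 'v set set \<Rightarrow> int \<Rightarrow> ('v set \<Rightarrow> 'f::field) set" where
  "cycles r K d = {c \<in> carrier (chain_space K d). boundary_map r K c = (\<lambda>_. 0)}"

definition boundaries :: "('v \<times> 'v) set \<Rightarrow> 'v set set \<Rightarrow> int \<Rightarrow> ('v set \<Rightarrow> 'f::field) set" where
  "boundaries r K d = boundary_map r K ` carrier (chain_space K (d + 1))"

definition quotient_module ::
  "('r, 'v, 'm) module_scheme \<Rightarrow> 'v set \<Rightarrow> ('r, 'v set) module" where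
  "quotient_module M N =
    \<lparr>carrier = a_rcosets\<^bsub>M\<^esub> N,
     mult = undefined, one = undefined,
     zero = N,
     add = (\<lambda>X Y. X <+>\<^bsub>M\<^esub> Y),
     smult = (\<lambda>a X. \<Union>x\<in>X. N +>\<^bsub>M\<^esub> (a \<odot>\<^bsub>M\<^esub> x))\<rparr>"

definition reduced_homology ::
  "('v \<times> 'v) set \<Rightarrow> 'v set set \<Rightarrow> int \<Rightarrow> ('f::field, ('v set \<Rightarrow> 'f) set) module" where
  "reduced_homology r K d =
    quotient_module ((chain_space K d)\<lparr>carrier := cycles r K d\<rparr>) (boundaries r K d)"

text \<open>The pair \<open>(i, j)\<close> stands for the edge joining left vertex \<open>i\<close> to right vertex \<open>j\<close>.\<close>

definition chessboard_complex :: "nat \<Rightarrow> nat \<Rightarrow> (nat \<times> nat) set set" where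
  "chessboard_complex m n =
    {M. M \<subseteq> {..<m} \<times> {..<n} \<and>
        (\<forall>e\<in>M. \<forall>e'\<in>M. e \<noteq> e' \<longrightarrow> fst e \<noteq> fst e' \<and> snd e \<noteq> snd e')}"

definition chessboard_betti :: "'f::field itself \<Rightarrow> nat \<Rightarrow> nat \<Rightarrow> int \<Rightarrow> nat" where
  "chessboard_betti _ m n d =
    vectorspace.dim (class_ring :: 'f ring)
      (reduced_homology (less_than <*lex*> less_than) (chessboard_complex m n) d)"

text \<open>Only used for \<open>b \<ge> 2\<close>, where the natural number subtractions do not truncate.\<close>

definition chessboard_betti_hat :: "'f::field itself \<Rightarrow> nat \<Rightarrow> nat \<Rightarrow> nat \<Rightarrow> nat" where
  "chessboard_betti_hat F k a b =
    chessboard_betti F (k + a + 3 * b - 1) (k + 2 * a + 3 * b - 1) (int (k + a + 2 * b) - 2)"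

text \<open>
  A polynomial in \<open>a\<close> and \<open>b\<close> is an element of \<open>\<real>[a][b]\<close>, so that \<open>coeff (coeff p j) i\<close> is the
  coefficient of \<open>a^i b^j\<close>. The total degree of the zero polynomial is \<open>-1\<close>.
\<close>

definition poly2 :: "real poly poly \<Rightarrow> real \<Rightarrow> real \<Rightarrow> real" where
  "poly2 p a b = poly (poly p [:b:]) a"

definition total_degree :: "real poly poly \<Rightarrow> int" where
  "total_degree p = Max (insert (-1) {int (i + j) | i j. coeff (coeff p j) i \<noteq> 0})"

end

theory Submission
  imports Defs "HOL-Library.Function_Algebras"
begin

text \<open>
  On functions on vertex sets let \<open>e \<and> _\<close> and contraction by \<open>e\<close> be the exterior multiplication and
  its adjoint. They anticommute up to \<open>\<delta>\<close>, and \<open>\<partial>\<close> is the sum of all contractions, so that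
  \<open>\<partial> (e \<and> c) = c - e \<and> \<partial> c\<close>. Write \<open>ij\<close> for the edge joining row \<open>i\<close> to column \<open>j\<close>.

  Fix a row \<open>i\<close> and columns \<open>p \<noteq> t\<close>. Up to at most \<open>n \<beta>(m-1,n-1,d-1)\<close> generators every class of
  \<open>M\<^sub>m\<^sub>n\<close> avoids row \<open>i\<close>, and such a class is a sum of classes \<open>(sp - ip) \<and> z\<close> with \<open>z\<close> avoiding the
  rows \<open>i, s\<close> and the column \<open>p\<close>. Up to \<open>(m-2) \<beta>(m-3,n-2,d-2)\<close> generators for each \<open>s\<close> the cycle
  \<open>z\<close> also avoids column \<open>t\<close>, and then \<open>sp \<and> z\<close> and \<open>it \<and> z\<close> are homologous. Hence
  \<open>\<beta>(m,n,d) \<le> \<beta>(m-1,n-2,d-1) + (m-1)(m-2) \<beta>(m-3,n-2,d-2) + n \<beta>(m-1,n-1,d-1)\<close>.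

  In the parameters \<open>(k,a,b)\<close> the first term has the same \<open>k\<close> and the other two have \<open>k - 1\<close>. Iterating
  the first leads to \<open>(k,0,k+2)\<close>; for \<open>k = 0\<close> the other terms vanish and this end point is
  \<open>H\<^sub>2(M\<^sub>5\<^sub>5)\<close>, of dimension at most one. With \<open>P = ((a+3b)^3 - 9b^3)/3\<close> and suitable constants \<open>c\<^sub>k\<close>,
  \<open>f\<^sub>k = (P + c\<^sub>k (1+a+2b)^2)^k / k!\<close> is a supersolution of the recursion.
\<close>

section \<open>Chains, exterior multiplication and contraction\<close>

definition cscale :: "'f::field \<Rightarrow> ('s \<Rightarrow> 'f) \<Rightarrow> 's \<Rightarrow> 'f" where
  "cscale a c = (\<lambda>\<sigma>. a * c \<sigma>)"

lemma cscale_apply: "cscale a c \<sigma> = a * c \<sigma>"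
  by (simp add: cscale_def)

interpretation fs: vector_space "cscale :: 'f::field \<Rightarrow> ('s \<Rightarrow> 'f) \<Rightarrow> 's \<Rightarrow> 'f"
  by unfold_locales (auto simp: cscale_def fun_eq_iff algebra_simps)

abbreviation fun_linear :: "(('s \<Rightarrow> 'f::field) \<Rightarrow> ('t \<Rightarrow> 'f)) \<Rightarrow> bool" where
  "fun_linear \<equiv> module_hom cscale cscale"

lemma fun_linearI:
  assumes "\<And>x y. h (x + y) = h x + h y" "\<And>a x. h (cscale a x) = cscale a (h x)"
  shows "fun_linear h"
  using assms by (simp add: module_hom_iff fs.module_axioms)

text \<open>The codimension of a preimage is at most that in the image: dropping one vector
  \<open>s\<close> from \<open>S\<close> replaces \<open>V\<close> by a subspace \<open>V'\<close>
  of codimension at most one. The new generators lie in \<open>V\<close>, although \<open>S\<close>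
  need not lie in the image of \<open>V\<close>.\<close>

lemma subspace_preimage_generators:
  fixes h :: "('s \<Rightarrow> 'f::field) \<Rightarrow> ('t \<Rightarrow> 'f)"
  assumes h: "fun_linear h" and V: "fs.subspace V" and "finite S"
    and im: "h ` V \<subseteq> fs.span (U \<union> S)"
  shows "\<exists>T\<subseteq>V. finite T \<and> card T \<le> card S \<and> V \<subseteq> fs.span (T \<union> {v \<in> V. h v \<in> fs.span U})"
  using \<open>finite S\<close> V im
proof (induction S arbitrary: V rule: finite_induct)
  case empty
  then have "V \<subseteq> {v \<in> V. h v \<in> fs.span U}" by (auto simp: image_subset_iff)
  also have "\<dots> \<subseteq> fs.span ({} \<union> \<dots>)" using fs.span_superset by simp
  finally show ?case by (intro exI[of _ "{}"]) simp
next
  case (insert s S)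
  interpret h: module_hom cscale cscale h by (rule h)
  define V' where "V' = {v \<in> V. h v \<in> fs.span (U \<union> S)}"
  have V': "fs.subspace V'"
    unfolding V'_def
    using fs.subspace_inter[OF insert.prems(1) h.subspace_linear_preimage[OF fs.subspace_span]]
    by (simp add: Int_def)
  have eq: "{v \<in> V'. h v \<in> fs.span U} = {v \<in> V. h v \<in> fs.span U}"
    unfolding V'_def using fs.span_mono[of U "U \<union> S"] by auto
  have "h ` V' \<subseteq> fs.span (U \<union> S)" by (auto simp: V'_def)
  from insert.IH[OF V' this] obtain T where T: "T \<subseteq> V'" "finite T" "card T \<le> card S"
    "V' \<subseteq> fs.span (T \<union> {v \<in> V. h v \<in> fs.span U})" unfolding eq by blast
  show ?case
  proof (cases "V' = V")
    case True
    then show ?thesis using T insert.hyps by (intro exI[of _ T]) auto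
  next
    case False
    then obtain v where v: "v \<in> V" "h v \<notin> fs.span (U \<union> S)" by (auto simp: V'_def)
    have dec: "\<exists>k. h x - cscale k s \<in> fs.span (U \<union> S)" if "x \<in> V" for x
      using insert.prems(2) that fs.span_breakdown_eq[of "h x" s "U \<union> S"] by auto
    obtain kv where kv: "h v - cscale kv s \<in> fs.span (U \<union> S)" using dec[OF v(1)] by auto
    have kv0: "kv \<noteq> 0" using kv v by auto
    have "x \<in> fs.span (insert v T \<union> {v \<in> V. h v \<in> fs.span U})" if x: "x \<in> V" for x
    proof -
      obtain k where k: "h x - cscale k s \<in> fs.span (U \<union> S)" using dec[OF x] by auto
      \<comment> \<open>Modulo \<open>fs.span (U \<union> S)\<close> the images of \<open>x\<close>
        and \<open>v\<close> are \<open>k\<close> and \<open>kv\<close> times \<open>s\<close>, so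
        this combination has no \<open>s\<close> left.\<close>
      let ?y = "x - cscale (k / kv) v"
      have "h ?y = (h x - cscale k s) - cscale (k / kv) (h v - cscale kv s)"
        using kv0 by (simp add: h.diff h.scale fs.scale_right_diff_distrib)
      also have "\<dots> \<in> fs.span (U \<union> S)" by (intro fs.span_diff fs.span_scale k kv)
      finally have "?y \<in> V'"
        unfolding V'_def using x v insert.prems(1)
        by (auto intro!: fs.subspace_diff fs.subspace_scale)
      then have "?y \<in> fs.span (insert v T \<union> {v \<in> V. h v \<in> fs.span U})"
        using T(4) fs.span_mono[of "T \<union> {v \<in> V. h v \<in> fs.span U}"
            "insert v T \<union> {v \<in> V. h v \<in> fs.span U}"] by blast
      moreover have "cscale (k / kv) v \<in> fs.span (insert v T \<union> {v \<in> V. h v \<in> fs.span U})"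
        by (intro fs.span_scale fs.span_base) auto
      ultimately show ?thesis
        using fs.span_add by fastforce
    qed
    moreover have "card (insert v T) \<le> card (insert s S)"
      using T insert.hyps by (simp add: card_insert_if)
    ultimately show ?thesis
      using T v by (intro exI[of _ "insert v T"]) (auto simp: V'_def)
  qed
qed

text \<open>The conditions \<open>h i v \<in> fs.span (U i)\<close> are imposed one index at a time,
  each costing at most \<open>N\<close> generators.\<close>

lemma subspace_preimages_generators:
  fixes h :: "'i \<Rightarrow> ('s \<Rightarrow> 'f::field) \<Rightarrow> ('t \<Rightarrow> 'f)"
  assumes "finite I" and h: "\<And>i. i \<in> I \<Longrightarrow> fun_linear (h i)" and V: "fs.subspace V"
    and S: "\<And>i. i \<in> I \<Longrightarrow> \<exists>S. finite S \<and> card S \<le> N \<and> h i ` V \<subseteq> fs.span (U i \<union> S)"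
  shows "\<exists>T\<subseteq>V. finite T \<and> card T \<le> card I * N
    \<and> V \<subseteq> fs.span (T \<union> {v \<in> V. \<forall>i\<in>I. h i v \<in> fs.span (U i)})"
  using \<open>finite I\<close> h S
proof (induction I rule: finite_induct)
  case empty
  then show ?case by (intro exI[of _ "{}"]) (simp add: fs.span_superset)
next
  case (insert i I)
  define V' where "V' = {v \<in> V. \<forall>i\<in>I. h i v \<in> fs.span (U i)}"
  have "\<exists>T\<subseteq>V. finite T \<and> card T \<le> card I * N \<and> V \<subseteq> fs.span (T \<union> V')"
    unfolding V'_def by (rule insert.IH) (use insert.prems in auto)
  then obtain T where T: "T \<subseteq> V" "finite T" "card T \<le> card I * N" "V \<subseteq> fs.span (T \<union> V')"
    by blast
  obtain S where S: "finite S" "card S \<le> N" "h i ` V \<subseteq> fs.span (U i \<union> S)"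
    using insert.prems by blast
  have V': "fs.subspace V'"
  proof -
    have "fs.subspace (V \<inter> (\<Inter>i\<in>I. {v. h i v \<in> fs.span (U i)}))"
      by (intro fs.subspace_inter fs.subspace_Int V module_hom.subspace_linear_preimage
          fs.subspace_span) (use insert.prems(1) in auto)
    also have "V \<inter> (\<Inter>i\<in>I. {v. h i v \<in> fs.span (U i)}) = V'" by (auto simp: V'_def)
    finally show ?thesis .
  qed
  have "h i ` V' \<subseteq> fs.span (U i \<union> S)" using S by (auto simp: V'_def)
  from subspace_preimage_generators[OF insert.prems(1)[OF insertI1] V' S(1) this]
  obtain T' where T': "T' \<subseteq> V'" "finite T'" "card T' \<le> card S"
    "V' \<subseteq> fs.span (T' \<union> {v \<in> V'. h i v \<in> fs.span (U i)})" by blast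
  let ?W = "{v \<in> V. \<forall>j\<in>insert i I. h j v \<in> fs.span (U j)}"
  have "V' \<subseteq> fs.span (T' \<union> ?W)"
    using T'(4) by (rule order_trans) (auto intro!: fs.span_mono simp: V'_def)
  then have "T \<union> V' \<subseteq> fs.span (T \<union> T' \<union> ?W)"
    using fs.span_mono[of "T' \<union> ?W" "T \<union> T' \<union> ?W"] fs.span_superset[of "T \<union> T' \<union> ?W"] by auto
  then have "V \<subseteq> fs.span (T \<union> T' \<union> ?W)"
    using T(4) fs.span_minimal[OF _ fs.subspace_span] by (meson order_trans)
  moreover have "card (T \<union> T') \<le> card (insert i I) * N"
    using card_Un_le[of T T'] T T' S insert.hyps by simp
  ultimately show ?case
    using T T' by (intro exI[of _ "T \<union> T'"]) (auto simp: V'_def)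
qed

text \<open>Off the diagonal the terms cancel in pairs. The diagonal is a separate hypothesis
  because in characteristic two \<open>F i i = - F i i\<close> holds for nonzero values as
  well.\<close>

lemma sum_antisymmetric:
  fixes F :: "'i \<Rightarrow> 'i \<Rightarrow> 'a::ab_group_add"
  assumes "finite I" "\<And>i. i \<in> I \<Longrightarrow> F i i = 0" "\<And>i j. i \<in> I \<Longrightarrow> j \<in> I \<Longrightarrow> F i j = - F j i"
  shows "(\<Sum>i\<in>I. \<Sum>j\<in>I. F i j) = 0"
  using assms
proof (induction I rule: finite_induct)
  case empty
  show ?case by simp
next
  case (insert x I)
  have "(\<Sum>i\<in>I. F i x) = (\<Sum>i\<in>I. - F x i)"
    by (rule sum.cong) (simp, metis insert.prems(2) insertCI)
  moreover have "(\<Sum>i\<in>I. \<Sum>j\<in>I. F i j) = 0"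
    by (rule insert.IH) (metis insert.prems insertCI)+
  moreover have "F x x = 0" by (rule insert.prems(1)) simp
  moreover have "(\<Sum>i\<in>insert x I. \<Sum>j\<in>insert x I. F i j)
      = F x x + (\<Sum>j\<in>I. F x j) + ((\<Sum>i\<in>I. F i x) + (\<Sum>i\<in>I. \<Sum>j\<in>I. F i j))"
    by (simp only: sum.insert[OF insert.hyps] sum.distrib add_ac)
  ultimately show ?case
    by (simp only: sum_negf add.right_neutral add.left_neutral add.right_inverse)
qed

text \<open>\<open>F\<close> fixes the coefficient field, which statements about mere numbers such
  as \<open>board_le\<close> could not determine.\<close>

locale chain_operators =
  fixes F :: "'f::field itself" and r :: "('v \<times> 'v) set" and E :: "'v set"
  assumes finite_E: "finite E"
    and irrefl: "(v, v) \<notin> r"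
    and asym: "u \<noteq> v \<Longrightarrow> (u, v) \<in> r \<longleftrightarrow> (v, u) \<notin> r"
begin

text \<open>Intersecting with the finite set \<open>E\<close> makes the sign rules hold for infinite \<open>\<sigma>\<close> too.\<close>

definition vsign :: "'v \<Rightarrow> 'v set \<Rightarrow> 'f" where
  "vsign v \<sigma> = (-1) ^ card {u \<in> \<sigma> \<inter> E. (u, v) \<in> r}"

definition wedge :: "'v \<Rightarrow> ('v set \<Rightarrow> 'f) \<Rightarrow> 'v set \<Rightarrow> 'f" where
  "wedge v c = (\<lambda>\<sigma>. if v \<in> \<sigma> then vsign v \<sigma> * c (\<sigma> - {v}) else 0)"

definition contr :: "'v \<Rightarrow> ('v set \<Rightarrow> 'f) \<Rightarrow> 'v set \<Rightarrow> 'f" where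
  "contr v c = (\<lambda>\<tau>. if v \<in> \<tau> then 0 else vsign v \<tau> * c (insert v \<tau>))"

definition bdry :: "('v set \<Rightarrow> 'f) \<Rightarrow> 'v set \<Rightarrow> 'f" where
  "bdry c = (\<Sum>v\<in>E. contr v c)"

section \<open>Anticommutation relations and the boundary operator\<close>

lemma vsign_square [simp]: "vsign v \<sigma> * vsign v \<sigma> = 1"
  by (simp add: vsign_def flip: power_add)

lemma vsign_insert_same [simp]: "vsign v (insert v \<sigma>) = vsign v \<sigma>"
proof -
  have "{u \<in> insert v \<sigma> \<inter> E. (u, v) \<in> r} = {u \<in> \<sigma> \<inter> E. (u, v) \<in> r}" using irrefl by auto
  then show ?thesis by (simp add: vsign_def)
qed

lemma vsign_remove_same [simp]: "vsign v (\<sigma> - {v}) = vsign v \<sigma>"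
proof -
  have "{u \<in> (\<sigma> - {v}) \<inter> E. (u, v) \<in> r} = {u \<in> \<sigma> \<inter> E. (u, v) \<in> r}" using irrefl by auto
  then show ?thesis by (simp add: vsign_def)
qed

lemma vsign_insert:
  assumes "v \<in> E" "v \<notin> \<sigma>"
  shows "vsign u (insert v \<sigma>) = (if (v, u) \<in> r then - vsign u \<sigma> else vsign u \<sigma>)"
proof (cases "(v, u) \<in> r")
  case True
  then have "{w \<in> insert v \<sigma> \<inter> E. (w, u) \<in> r} = insert v {w \<in> \<sigma> \<inter> E. (w, u) \<in> r}"
    using assms by auto
  then show ?thesis using True assms finite_E by (simp add: vsign_def)
next
  case False
  then have "{w \<in> insert v \<sigma> \<inter> E. (w, u) \<in> r} = {w \<in> \<sigma> \<inter> E. (w, u) \<in> r}" by auto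
  then show ?thesis using False by (simp add: vsign_def)
qed

lemma contr_wedge_same: "contr v (wedge v c) + wedge v (contr v c) = c"
proof
  fix \<sigma>
  show "(contr v (wedge v c) + wedge v (contr v c)) \<sigma> = c \<sigma>"
    by (auto simp: contr_def wedge_def insert_absorb simp flip: mult.assoc)
qed

lemma wedge_contr_apply: "wedge v (contr v c) \<sigma> = (if v \<in> \<sigma> then c \<sigma> else 0)"
  by (auto simp: contr_def wedge_def insert_absorb simp flip: mult.assoc)

text \<open>Exactly one of \<open>(u, v)\<close> and \<open>(v, u)\<close> lies in \<open>r\<close>,
  so interchanging the two operations flips exactly one of the two signs. The same count gives
  \<open>contr_contr\<close> and \<open>wedge_wedge\<close>.\<close>

lemma contr_wedge:
  fixes c :: "'v set \<Rightarrow> 'f"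
  assumes "u \<in> E" "v \<in> E" "u \<noteq> v"
  shows "contr v (wedge u c) = - wedge u (contr v c)"
proof
  fix \<sigma>
  show "contr v (wedge u c) \<sigma> = (- wedge u (contr v c)) \<sigma>"
  proof (cases "v \<notin> \<sigma> \<and> u \<in> \<sigma>")
    case True
    have 1: "(vsign u (insert v \<sigma>) :: 'f) = (if (v, u) \<in> r then - vsign u \<sigma> else vsign u \<sigma>)"
      using vsign_insert[of v \<sigma> u] True assms by simp
    have 2: "(vsign v \<sigma> :: 'f) = (if (u, v) \<in> r then - vsign v (\<sigma> - {u}) else vsign v (\<sigma> - {u}))"
      using vsign_insert[of u "\<sigma> - {u}" v] True assms by (auto simp: insert_absorb)
    have 3: "insert v (\<sigma> - {u}) = insert v \<sigma> - {u}" using True assms by auto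
    show ?thesis
      using True assms asym[of u v] by (auto simp: contr_def wedge_def 1 2 3)
  qed (use assms in \<open>auto simp: contr_def wedge_def\<close>)
qed

lemma contr_contr:
  fixes c :: "'v set \<Rightarrow> 'f"
  assumes "u \<in> E" "v \<in> E"
  shows "contr u (contr v c) = (if u = v then 0 else - contr v (contr u c))"
proof
  fix \<sigma>
  show "contr u (contr v c) \<sigma> = (if u = v then 0 else - contr v (contr u c)) \<sigma>"
  proof (cases "u \<noteq> v \<and> u \<notin> \<sigma> \<and> v \<notin> \<sigma>")
    case True
    have 1: "(vsign u (insert v \<sigma>) :: 'f) = (if (v, u) \<in> r then - vsign u \<sigma> else vsign u \<sigma>)"
      using vsign_insert[of v \<sigma> u] True assms by auto
    have 2: "(vsign v (insert u \<sigma>) :: 'f) = (if (u, v) \<in> r then - vsign v \<sigma> else vsign v \<sigma>)"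
      using vsign_insert[of u \<sigma> v] True assms by auto
    show ?thesis
      using True asym[of u v] by (auto simp: contr_def 1 2 insert_commute)
  qed (auto simp: contr_def)
qed

lemma wedge_wedge:
  fixes c :: "'v set \<Rightarrow> 'f"
  assumes "u \<in> E" "v \<in> E"
  shows "wedge u (wedge v c) = (if u = v then 0 else - wedge v (wedge u c))"
proof
  fix \<sigma>
  show "wedge u (wedge v c) \<sigma> = (if u = v then 0 else - wedge v (wedge u c)) \<sigma>"
  proof (cases "u \<noteq> v \<and> u \<in> \<sigma> \<and> v \<in> \<sigma>")
    case True
    have 1: "(vsign u \<sigma> :: 'f) = (if (v, u) \<in> r then - vsign u (\<sigma> - {v}) else vsign u (\<sigma> - {v}))"
      using vsign_insert[of v "\<sigma> - {v}" u] True assms by (auto simp: insert_absorb)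
    have 2: "(vsign v \<sigma> :: 'f) = (if (u, v) \<in> r then - vsign v (\<sigma> - {u}) else vsign v (\<sigma> - {u}))"
      using vsign_insert[of u "\<sigma> - {u}" v] True assms by (auto simp: insert_absorb)
    have 3: "\<sigma> - {u} - {v} = \<sigma> - {v} - {u}" by auto
    have ne: "u \<noteq> v" "v \<noteq> u" using True by auto
    have "wedge u (wedge v c) \<sigma> = vsign u \<sigma> * (vsign v (\<sigma> - {u}) * c (\<sigma> - {v} - {u}))"
      using True ne by (simp add: wedge_def 3)
    moreover have "wedge v (wedge u c) \<sigma> = vsign v \<sigma> * (vsign u (\<sigma> - {v}) * c (\<sigma> - {v} - {u}))"
      using True ne by (simp add: wedge_def)
    ultimately show ?thesis
      using True asym[of u v] by (cases "(u, v) \<in> r") (simp_all add: 1 2)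
  qed (auto simp: wedge_def)
qed

lemma linear_wedge: "fun_linear (wedge v)"
  by (rule fun_linearI) (auto simp: wedge_def fun_eq_iff cscale_apply algebra_simps)

lemma linear_contr: "fun_linear (contr v)"
  by (rule fun_linearI) (auto simp: contr_def fun_eq_iff cscale_apply algebra_simps)

lemma linear_bdry: "fun_linear bdry"
proof -
  interpret c: module_hom cscale cscale "contr v" for v by (rule linear_contr)
  show ?thesis
    by (rule fun_linearI) (simp_all add: bdry_def c.add c.scale sum.distrib fs.scale_sum_right)
qed

text \<open>The summand \<open>v = u\<close> of the boundary contributes
  \<open>c - wedge u (contr u c)\<close>; the others anticommute with \<open>wedge u\<close>. On a
  cycle \<open>c\<close>, therefore, \<open>wedge u c\<close> is a cone that bounds
  \<open>c\<close>.\<close>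

lemma bdry_wedge:
  assumes "u \<in> E"
  shows "bdry (wedge u c) = c - wedge u (bdry c)"
proof -
  interpret w: module_hom cscale cscale "wedge u" by (rule linear_wedge)
  have "bdry (wedge u c) = contr u (wedge u c) + (\<Sum>v\<in>E - {u}. contr v (wedge u c))"
    unfolding bdry_def using finite_E assms by (rule sum.remove)
  also have "(\<Sum>v\<in>E - {u}. contr v (wedge u c)) = (\<Sum>v\<in>E - {u}. - wedge u (contr v c))"
    by (rule sum.cong) (use assms contr_wedge in auto)
  also have "\<dots> = - (wedge u (\<Sum>v\<in>E - {u}. contr v c))"
    by (simp add: w.sum sum_negf)
  also have "(\<Sum>v\<in>E - {u}. contr v c) = bdry c - contr u c"
    unfolding bdry_def using finite_E assms by (simp add: sum_diff1)
  also have "contr u (wedge u c) + - wedge u (bdry c - contr u c)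
      = (contr u (wedge u c) + wedge u (contr u c)) - wedge u (bdry c)"
    by (simp add: w.diff algebra_simps)
  finally show ?thesis by (simp add: contr_wedge_same)
qed

text \<open>Makes contraction a chain map up to sign, so that the part of a cycle around an edge is
  a cycle in the link of that edge.\<close>

lemma contr_bdry:
  assumes "v \<in> E"
  shows "contr v (bdry c) = - bdry (contr v c)"
proof -
  interpret k: module_hom cscale cscale "contr v" by (rule linear_contr)
  have "contr v (bdry c) = (\<Sum>u\<in>E. contr v (contr u c))"
    by (simp add: bdry_def k.sum)
  also have "\<dots> = (\<Sum>u\<in>E. - contr u (contr v c))"
  proof (rule sum.cong)
    show "contr v (contr u c) = - contr u (contr v c)" if "u \<in> E" for u
      using contr_contr[OF assms that, of c] contr_contr[OF assms assms, of c]
      by (cases "u = v") auto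
  qed simp
  finally show ?thesis by (simp add: bdry_def sum_negf)
qed

lemma bdry_bdry: "bdry (bdry c) = 0"
proof -
  interpret k: module_hom cscale cscale "contr v" for v by (rule linear_contr)
  have "bdry (bdry c) = (\<Sum>u\<in>E. \<Sum>v\<in>E. contr u (contr v c))"
    by (simp add: bdry_def k.sum)
  also have "\<dots> = 0"
  proof (rule sum_antisymmetric[OF finite_E])
    show "contr i (contr i c) = 0" if "i \<in> E" for i
      using contr_contr[OF that that, of c] by simp
    show "contr i (contr j c) = - contr j (contr i c)" if "i \<in> E" "j \<in> E" for i j
      using contr_contr[OF that, of c] contr_contr[OF that(1) that(1), of c] by (auto split: if_splits)
  qed
  finally show ?thesis .
qed

text \<open>The index \<open>q\<close> is the number of vertices, one more than the dimension.\<close>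

definition chains :: "'v set set \<Rightarrow> nat \<Rightarrow> ('v set \<Rightarrow> 'f) set" where
  "chains K q = {c. \<forall>\<sigma>. c \<sigma> \<noteq> 0 \<longrightarrow> \<sigma> \<in> K \<and> card \<sigma> = q}"

definition cyc :: "'v set set \<Rightarrow> nat \<Rightarrow> ('v set \<Rightarrow> 'f) set" where
  "cyc K q = {c \<in> chains K q. bdry c = 0}"

definition bnd :: "'v set set \<Rightarrow> nat \<Rightarrow> ('v set \<Rightarrow> 'f) set" where
  "bnd K q = bdry ` chains K (Suc q)"

lemma subspace_chains: "fs.subspace (chains K q :: ('v set \<Rightarrow> 'f) set)"
proof (unfold fs.subspace_def, intro conjI ballI allI)
  fix x y :: "'v set \<Rightarrow> 'f" and a :: 'f
  assume x: "x \<in> chains K q"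
  then show "cscale a x \<in> chains K q" by (simp add: chains_def cscale_apply)
  assume y: "y \<in> chains K q"
  show "x + y \<in> chains K q"
    unfolding chains_def
  proof (intro CollectI allI impI)
    fix \<sigma> assume "(x + y) \<sigma> \<noteq> 0"
    then have "x \<sigma> \<noteq> 0 \<or> y \<sigma> \<noteq> 0" by auto
    then show "\<sigma> \<in> K \<and> card \<sigma> = q" using x y by (auto simp: chains_def)
  qed
qed (simp add: chains_def)

lemma subspace_cyc: "fs.subspace (cyc K q)"
proof -
  interpret d: module_hom cscale cscale bdry by (rule linear_bdry)
  show ?thesis
    unfolding cyc_def using fs.subspace_inter[OF subspace_chains d.subspace_kernel]
    by (simp add: Int_def)
qed

lemma subspace_bnd: "fs.subspace (bnd K q)"
proof -
  interpret d: module_hom cscale cscale bdry by (rule linear_bdry)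
  show ?thesis unfolding bnd_def by (intro d.subspace_image subspace_chains)
qed

lemma chains_mono: "K \<subseteq> L \<Longrightarrow> chains K q \<subseteq> chains L q"
  by (auto simp: chains_def)

lemma cyc_mono: "K \<subseteq> L \<Longrightarrow> cyc K q \<subseteq> cyc L q"
  by (auto simp: cyc_def dest: subsetD[OF chains_mono])

lemma bdry_in_bnd: "c \<in> chains K (Suc q) \<Longrightarrow> bdry c \<in> bnd K q"
  by (simp add: bnd_def)

end

section \<open>Chessboard complexes\<close>

lemma sum_fun_apply: "(\<Sum>i\<in>I. f i) x = (\<Sum>i\<in>I. f i x)"
  by (induction I rule: infinite_finite_induct) auto

context chain_operators
begin

text \<open>The labelling \<open>g\<close> of the edges is arbitrary: exchanging its arguments gives the symmetry
  between rows and columns without comparing two orders on the vertices.\<close>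

definition rooks :: "(nat \<Rightarrow> nat \<Rightarrow> 'v) \<Rightarrow> nat set \<Rightarrow> nat set \<Rightarrow> 'v set set" where
  "rooks g A B = {\<sigma>. \<sigma> \<subseteq> {g i j | i j. i \<in> A \<and> j \<in> B} \<and>
    (\<forall>i j i' j'. g i j \<in> \<sigma> \<longrightarrow> g i' j' \<in> \<sigma> \<longrightarrow> (i = i' \<longleftrightarrow> j = j'))}"

text \<open>Injectivity is required on all pairs, as the non-attacking condition in
  \<open>rooks\<close> also ranges over all pairs; one labelling then serves every subboard.\<close>

definition board :: "(nat \<Rightarrow> nat \<Rightarrow> 'v) \<Rightarrow> nat set \<Rightarrow> nat set \<Rightarrow> bool" where
  "board g A B \<longleftrightarrow> (\<forall>i j i' j'. g i j = g i' j' \<longrightarrow> i = i' \<and> j = j') \<and>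
    finite A \<and> finite B \<and> (\<forall>i\<in>A. \<forall>j\<in>B. g i j \<in> E)"

section \<open>Placing and removing rooks\<close>

lemma rooks_transpose: "rooks (\<lambda>i j. g j i) B A = rooks g A B"
  unfolding rooks_def by blast

lemma board_transpose: "board (\<lambda>i j. g j i) B A \<longleftrightarrow> board g A B"
  unfolding board_def by blast

lemma board_subset: "board g A B \<Longrightarrow> A' \<subseteq> A \<Longrightarrow> B' \<subseteq> B \<Longrightarrow> board g A' B'"
  unfolding board_def by (blast intro: finite_subset)

lemma board_E: "board g A B \<Longrightarrow> i \<in> A \<Longrightarrow> p \<in> B \<Longrightarrow> g i p \<in> E"
  by (simp add: board_def)

lemma board_inj: "board g A B \<Longrightarrow> g i j = g i' j' \<longleftrightarrow> i = i' \<and> j = j'"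
  unfolding board_def by blast

lemma board_finite: "board g A B \<Longrightarrow> finite A" "board g A B \<Longrightarrow> finite B"
  by (auto simp: board_def)

lemma rooks_mono: "A \<subseteq> A' \<Longrightarrow> B \<subseteq> B' \<Longrightarrow> rooks g A B \<subseteq> rooks g A' B'"
  unfolding rooks_def by fast

lemma rooks_downward: "\<sigma> \<in> rooks g A B \<Longrightarrow> \<tau> \<subseteq> \<sigma> \<Longrightarrow> \<tau> \<in> rooks g A B"
  unfolding rooks_def by blast

lemma rooks_subset_E: "board g A B \<Longrightarrow> \<sigma> \<in> rooks g A B \<Longrightarrow> \<sigma> \<subseteq> E"
  unfolding rooks_def board_def by blast

lemma finite_rook: "board g A B \<Longrightarrow> \<sigma> \<in> rooks g A B \<Longrightarrow> finite \<sigma>"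
  by (rule finite_subset[OF rooks_subset_E finite_E])

text \<open>\<open>z\<close> leaves row \<open>i\<close> and column \<open>p\<close> empty, so a
  rook may be added at their crossing.\<close>

lemma wedge_chains:
  assumes b: "board g A B" and i: "i \<in> A" and p: "p \<in> B"
    and z: "z \<in> chains (rooks g A' B') q" and A': "A' \<subseteq> A - {i}" and B': "B' \<subseteq> B - {p}"
  shows "wedge (g i p) z \<in> chains (rooks g A B) (Suc q)"
  unfolding chains_def
proof (intro CollectI allI impI)
  fix \<sigma> assume "wedge (g i p) z \<sigma> \<noteq> 0"
  then have in\<sigma>: "g i p \<in> \<sigma>" and nz: "z (\<sigma> - {g i p}) \<noteq> 0"
    by (auto simp: wedge_def split: if_splits)
  from nz z have r: "\<sigma> - {g i p} \<in> rooks g A' B'" and card: "card (\<sigma> - {g i p}) = q"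
    by (auto simp: chains_def)
  have "board g A' B'" using b A' B' by (blast intro: board_subset)
  then have "finite (\<sigma> - {g i p})" using r by (rule finite_rook)
  then have "card \<sigma> = Suc q" using card_Suc_Diff1[OF _ in\<sigma>] card by simp
  moreover have "\<sigma> \<in> rooks g A B"
    unfolding rooks_def
  proof (intro CollectI conjI allI impI)
    have "\<sigma> - {g i p} \<subseteq> {g i j | i j. i \<in> A \<and> j \<in> B}"
      using r A' B' unfolding rooks_def by blast
    then show "\<sigma> \<subseteq> {g i j | i j. i \<in> A \<and> j \<in> B}" using i p by blast
  next
    fix j k j' k' assume jk: "g j k \<in> \<sigma>" "g j' k' \<in> \<sigma>"
    have ne: "j \<noteq> i \<and> k \<noteq> p" if "g j k \<in> \<sigma>" "g j k \<noteq> g i p" for j k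
    proof -
      have "g j k \<in> \<sigma> - {g i p}" using that by auto
      then obtain a b' where "g j k = g a b'" "a \<in> A'" "b' \<in> B'" using r unfolding rooks_def by blast
      then show ?thesis using A' B' board_inj[OF b] by auto
    qed
    show "j = j' \<longleftrightarrow> k = k'"
    proof (cases "g j k = g i p \<or> g j' k' = g i p")
      case True
      then show ?thesis using ne[OF jk(1)] ne[OF jk(2)] board_inj[OF b] by metis
    next
      case False
      then have "g j k \<in> \<sigma> - {g i p}" "g j' k' \<in> \<sigma> - {g i p}" using jk by auto
      then show ?thesis using r unfolding rooks_def by blast
    qed
  qed
  ultimately show "\<sigma> \<in> rooks g A B \<and> card \<sigma> = Suc q" by simp
qed

text \<open>The link of the vertex \<open>g i p\<close> is the complex of the board without row
  \<open>i\<close> and column \<open>p\<close>.\<close>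

lemma contr_chains:
  assumes b: "board g A B" and c: "c \<in> chains (rooks g A B) (Suc q)"
  shows "contr (g i p) c \<in> chains (rooks g (A - {i}) (B - {p})) q"
  unfolding chains_def
proof (intro CollectI allI impI)
  fix \<tau> assume "contr (g i p) c \<tau> \<noteq> 0"
  then have notin: "g i p \<notin> \<tau>" and nz: "c (insert (g i p) \<tau>) \<noteq> 0"
    by (auto simp: contr_def split: if_splits)
  from nz c have r: "insert (g i p) \<tau> \<in> rooks g A B" and card: "card (insert (g i p) \<tau>) = Suc q"
    by (auto simp: chains_def)
  have "finite \<tau>" using finite_rook[OF b r] by simp
  then have "card \<tau> = q" using card notin by simp
  moreover have "\<tau> \<in> rooks g (A - {i}) (B - {p})"
    unfolding rooks_def
  proof (intro CollectI conjI allI impI)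
    show "\<tau> \<subseteq> {g i' j | i' j. i' \<in> A - {i} \<and> j \<in> B - {p}}"
    proof
      fix v assume v: "v \<in> \<tau>"
      then obtain j k where jk: "v = g j k" "j \<in> A" "k \<in> B" using r unfolding rooks_def by blast
      have "g j k \<in> insert (g i p) \<tau>" using v jk by simp
      then have "j = i \<longleftrightarrow> k = p" using r unfolding rooks_def by blast
      moreover have "\<not> (j = i \<and> k = p)" using v jk notin by auto
      ultimately show "v \<in> {g i' j | i' j. i' \<in> A - {i} \<and> j \<in> B - {p}}"
        using jk by auto
    qed
  next
    fix j k j' k' assume "g j k \<in> \<tau>" "g j' k' \<in> \<tau>"
    then show "j = j' \<longleftrightarrow> k = k'" using r unfolding rooks_def by blast
  qed
  ultimately show "\<tau> \<in> rooks g (A - {i}) (B - {p}) \<and> card \<tau> = q" by simp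
qed

text \<open>A face has at most one rook in column \<open>p\<close>, so the sum over the rows returns
  \<open>c \<sigma>\<close> exactly when \<open>\<sigma>\<close> meets that column, and the
  difference keeps only the other faces.\<close>

lemma remove_column_chains:
  assumes b: "board g A B" and p: "p \<in> B" and c: "c \<in> chains (rooks g A B) q"
  shows "c - (\<Sum>i\<in>A. wedge (g i p) (contr (g i p) c)) \<in> chains (rooks g A (B - {p})) q"
  unfolding chains_def
proof (intro CollectI allI impI)
  fix \<sigma>
  let ?d = "c - (\<Sum>i\<in>A. wedge (g i p) (contr (g i p) c))"
  assume nz: "?d \<sigma> \<noteq> 0"
  have val: "?d \<sigma> = c \<sigma> - (\<Sum>i\<in>A. if g i p \<in> \<sigma> then c \<sigma> else 0)"
    by (simp add: sum_fun_apply wedge_contr_apply)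
  have "c \<sigma> \<noteq> 0" using nz val by (auto simp: sum.neutral)
  then have r: "\<sigma> \<in> rooks g A B" and card: "card \<sigma> = q" using c by (auto simp: chains_def)
  have no: "g i p \<notin> \<sigma>" if "i \<in> A" for i
  proof
    assume gi: "g i p \<in> \<sigma>"
    have "(\<Sum>j\<in>A. if g j p \<in> \<sigma> then c \<sigma> else 0) = (\<Sum>j\<in>A. if j = i then c \<sigma> else 0)"
      by (rule sum.cong) (use r gi in \<open>auto simp: rooks_def\<close>)
    then show False using nz val that board_finite[OF b] by simp
  qed
  have "\<sigma> \<in> rooks g A (B - {p})" using r no unfolding rooks_def by fast
  then show "\<sigma> \<in> rooks g A (B - {p}) \<and> card \<sigma> = q" using card by simp
qed

lemma bdry_chains:
  assumes b: "board g A B" and c: "c \<in> chains (rooks g A B) (Suc q)"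
  shows "bdry c \<in> chains (rooks g A B) q"
  unfolding bdry_def
proof (rule fs.subspace_sum[OF subspace_chains])
  fix v
  show "contr v c \<in> chains (rooks g A B) q"
    unfolding chains_def
  proof (intro CollectI allI impI)
    fix \<tau> assume "contr v c \<tau> \<noteq> 0"
    then have "v \<notin> \<tau>" "c (insert v \<tau>) \<noteq> 0" by (auto simp: contr_def split: if_splits)
    moreover from this have "insert v \<tau> \<in> rooks g A B" "card (insert v \<tau>) = Suc q"
      using c by (auto simp: chains_def)
    moreover from this have "finite \<tau>" using finite_rook[OF b, of "insert v \<tau>"] by simp
    ultimately show "\<tau> \<in> rooks g A B \<and> card \<tau> = q" by (auto intro: rooks_downward)
  qed
qed

lemma bnd_subset_cyc: "board g A B \<Longrightarrow> bnd (rooks g A B) q \<subseteq> cyc (rooks g A B) q"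
  by (auto simp: bnd_def cyc_def bdry_chains bdry_bdry)

lemma contr_cyc:
  assumes "board g A B" "c \<in> cyc (rooks g A B) (Suc q)" "g i p \<in> E"
  shows "contr (g i p) c \<in> cyc (rooks g (A - {i}) (B - {p})) q"
proof -
  interpret k: module_hom cscale cscale "contr (g i p)" by (rule linear_contr)
  have "bdry (contr (g i p) c) = 0"
    using contr_bdry[OF assms(3), of c] assms(2) by (simp add: cyc_def)
  then show ?thesis using assms contr_chains by (simp add: cyc_def)
qed

text \<open>Only the empty face has no vertices, and it belongs to every board.\<close>

lemma chains_0: "chains (rooks g A B) 0 \<subseteq> chains (rooks g A' B') 0" if "board g A B"
proof
  fix c assume c: "c \<in> chains (rooks g A B) 0"
  show "c \<in> chains (rooks g A' B') 0"
    unfolding chains_def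
  proof (intro CollectI allI impI)
    fix \<sigma> assume "c \<sigma> \<noteq> 0"
    then have "\<sigma> \<in> rooks g A B" "card \<sigma> = 0" using c by (auto simp: chains_def)
    then have "\<sigma> = {}" using finite_rook[OF that] by simp
    then show "\<sigma> \<in> rooks g A' B' \<and> card \<sigma> = 0" by (simp add: rooks_def)
  qed
qed

text \<open>Exterior product with the reduced 0-cycle \<open>u - v\<close>; this is why it respects
  cycles and boundaries wherever the placements are legal.\<close>

definition wdiff :: "'v \<Rightarrow> 'v \<Rightarrow> ('v set \<Rightarrow> 'f) \<Rightarrow> 'v set \<Rightarrow> 'f" where
  "wdiff u v z = wedge u z - wedge v z"

lemma linear_wdiff: "fun_linear (wdiff u v)"
proof -
  interpret w: module_hom cscale cscale "wedge v" for v by (rule linear_wedge)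
  show ?thesis
    by (rule fun_linearI)
      (simp_all add: wdiff_def w.add w.scale fs.scale_right_diff_distrib)
qed

lemma bdry_wdiff:
  assumes "u \<in> E" "v \<in> E"
  shows "bdry (wdiff u v z) = - wdiff u v (bdry z)"
proof -
  interpret d: module_hom cscale cscale bdry by (rule linear_bdry)
  show ?thesis using assms by (simp add: wdiff_def d.diff bdry_wedge)
qed

lemma wdiff_chains:
  assumes "board g A B" "s \<in> A" "i \<in> A" "p \<in> B" "t \<in> B" "z \<in> chains (rooks g A' B') q"
    "A' \<subseteq> A - {s, i}" "B' \<subseteq> B - {p, t}"
  shows "wdiff (g s p) (g i t) z \<in> chains (rooks g A B) (Suc q)"
  unfolding wdiff_def
  by (intro fs.subspace_diff[OF subspace_chains] wedge_chains[OF assms(1)])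
    (use assms in auto)

lemma wdiff_cyc:
  assumes "board g A B" "s \<in> A" "i \<in> A" "p \<in> B" "t \<in> B" "z \<in> cyc (rooks g A' B') q"
    "A' \<subseteq> A - {s, i}" "B' \<subseteq> B - {p, t}"
  shows "wdiff (g s p) (g i t) z \<in> cyc (rooks g A B) (Suc q)"
proof -
  interpret w: module_hom cscale cscale "wdiff u v" for u v by (rule linear_wdiff)
  show ?thesis
    using assms by (auto simp: cyc_def bdry_wdiff board_E intro!: wdiff_chains)
qed

lemma wdiff_bnd:
  assumes "board g A B" "s \<in> A" "i \<in> A" "p \<in> B" "t \<in> B" "z \<in> bnd (rooks g A' B') q"
    "A' \<subseteq> A - {s, i}" "B' \<subseteq> B - {p, t}"
  shows "wdiff (g s p) (g i t) z \<in> bnd (rooks g A B) (Suc q)"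
proof -
  interpret d: module_hom cscale cscale bdry by (rule linear_bdry)
  obtain y where y: "y \<in> chains (rooks g A' B') (Suc q)" "z = bdry y"
    using assms by (auto simp: bnd_def)
  have "wdiff (g s p) (g i t) z = bdry (- wdiff (g s p) (g i t) y)"
    using assms y by (simp add: bdry_wdiff board_E d.neg)
  moreover have "- wdiff (g s p) (g i t) y \<in> chains (rooks g A B) (Suc (Suc q))"
    by (intro fs.subspace_neg[OF subspace_chains] wdiff_chains[OF assms(1-5) y(1) assms(7-8)])
  ultimately show ?thesis using bdry_in_bnd by metis
qed

text \<open>The edges \<open>sp\<close> and \<open>it\<close> do not attack each other, so both can
  be added to \<open>z\<close> at once; up to sign the boundary of that product is the
  difference.\<close>

lemma wedge_move:
  assumes b: "board g A B" and "s \<in> A" "i \<in> A" "s \<noteq> i" "p \<in> B" "t \<in> B" "p \<noteq> t"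
    and z: "z \<in> cyc (rooks g A' B') q" and sub: "A' \<subseteq> A - {s, i}" "B' \<subseteq> B - {p, t}"
  shows "wdiff (g s p) (g i t) z \<in> bnd (rooks g A B) (Suc q)"
proof -
  interpret w: module_hom cscale cscale "wedge v" for v by (rule linear_wedge)
  interpret d: module_hom cscale cscale bdry by (rule linear_bdry)
  have "bdry (- wedge (g s p) (wedge (g i t) z)) = wdiff (g s p) (g i t) z"
    using z assms by (simp add: bdry_wedge d.neg wdiff_def cyc_def board_E)
  moreover have "wedge (g i t) z \<in> chains (rooks g (A - {s}) (B - {p})) (Suc q)"
    by (rule wedge_chains[OF board_subset[OF b]]) (use assms in \<open>auto simp: cyc_def\<close>)
  then have "- wedge (g s p) (wedge (g i t) z) \<in> chains (rooks g A B) (Suc (Suc q))"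
    by (intro fs.subspace_neg[OF subspace_chains] wedge_chains[OF b]) (use assms in auto)
  ultimately show ?thesis using bdry_in_bnd by metis
qed

end

section \<open>Generators of the homology\<close>

context chain_operators
begin

text \<open>A bound on the dimension of the homology by generators modulo boundaries, without
  forming the quotient. The set \<open>S\<close> may contain chains that are not cycles.\<close>

definition hom_le :: "'v set set \<Rightarrow> nat \<Rightarrow> nat \<Rightarrow> bool" where
  "hom_le K q N \<longleftrightarrow> (\<exists>S. finite S \<and> card S \<le> N \<and>
    (cyc K q :: ('v set \<Rightarrow> 'f) set) \<subseteq> fs.span (bnd K q \<union> S))"

text \<open>The bound ranges over all labelled boards of one size, so that it can be applied to any
  subboard of that size and survives transposition.\<close>

definition board_le :: "nat \<Rightarrow> nat \<Rightarrow> nat \<Rightarrow> nat \<Rightarrow> bool" where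
  "board_le m n q N \<longleftrightarrow> (\<forall>g A B. board g A B \<longrightarrow> card A = m \<longrightarrow> card B = n \<longrightarrow>
    hom_le (rooks g A B) q N)"

section \<open>Clearing rows and columns\<close>

lemma board_leD: "board_le m n q N \<Longrightarrow> board g A B \<Longrightarrow> card A = m \<Longrightarrow> card B = n \<Longrightarrow>
    hom_le (rooks g A B) q N"
  by (simp add: board_le_def)

lemma board_le_transpose:
  assumes "board_le m n q N"
  shows "board_le n m q N"
  unfolding board_le_def
proof (intro allI impI)
  fix g A B assume "board g A B" "card A = n" "card B = m"
  then show "hom_le (rooks g A B) q N"
    using board_leD[OF assms, of "\<lambda>i j. g j i" B A]
    by (simp add: board_transpose[of g] rooks_transpose[of g])
qed

lemma hom_le_0: "hom_le K q 0 \<longleftrightarrow> cyc K q \<subseteq> bnd K q"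
proof -
  have sp: "fs.span (bnd K q) = bnd K q" by (simp add: subspace_bnd)
  have "hom_le K q 0 \<longleftrightarrow> cyc K q \<subseteq> fs.span (bnd K q)"
    unfolding hom_le_def by (auto intro!: exI[of _ "{}"])
  then show ?thesis unfolding sp .
qed

text \<open>If the contraction at \<open>ip\<close> is the boundary of \<open>y i\<close>, adding
  the boundary of the sum of all \<open>ip \<and> y i\<close> trades the part of \<open>c\<close>
  through column \<open>p\<close> for the chains \<open>y i\<close>, which avoid that
  column.\<close>

lemma clear_column:
  assumes b: "board g A B" and p: "p \<in> B" and c: "c \<in> cyc (rooks g A B) (Suc q)"
    and k: "\<And>i. i \<in> A \<Longrightarrow> contr (g i p) c \<in> bnd (rooks g (A - {i}) (B - {p})) q"
  shows "\<exists>c'\<in>cyc (rooks g A (B - {p})) (Suc q). c - c' \<in> bnd (rooks g A B) (Suc q)"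
proof -
  interpret d: module_hom cscale cscale bdry by (rule linear_bdry)
  have "\<exists>y. y \<in> chains (rooks g (A - {i}) (B - {p})) (Suc q) \<and> contr (g i p) c = bdry y"
    if "i \<in> A" for i
    using k[OF that] by (auto simp: bnd_def)
  then obtain y where y: "\<And>i. i \<in> A \<Longrightarrow> y i \<in> chains (rooks g (A - {i}) (B - {p})) (Suc q)"
    "\<And>i. i \<in> A \<Longrightarrow> contr (g i p) c = bdry (y i)" by metis
  define e where "e = (\<Sum>i\<in>A. wedge (g i p) (y i))"
  define c' where "c' = c + bdry e"
  have e: "e \<in> chains (rooks g A B) (Suc (Suc q))"
    unfolding e_def
  proof (rule fs.subspace_sum[OF subspace_chains])
    show "wedge (g i p) (y i) \<in> chains (rooks g A B) (Suc (Suc q))" if "i \<in> A" for i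
      by (rule wedge_chains[OF b that p y(1)[OF that]]) auto
  qed
  have "bdry e = (\<Sum>i\<in>A. y i - wedge (g i p) (contr (g i p) c))"
    unfolding e_def d.sum
    by (rule sum.cong) (use y(2) b p in \<open>auto simp: bdry_wedge board_E\<close>)
  then have c'_eq: "c' = (c - (\<Sum>i\<in>A. wedge (g i p) (contr (g i p) c))) + (\<Sum>i\<in>A. y i)"
    by (simp add: c'_def sum_subtractf)
  have "(\<Sum>i\<in>A. y i) \<in> chains (rooks g A (B - {p})) (Suc q)"
  proof (rule fs.subspace_sum[OF subspace_chains])
    show "y i \<in> chains (rooks g A (B - {p})) (Suc q)" if "i \<in> A" for i
      by (rule subsetD[OF chains_mono y(1)[OF that]], rule rooks_mono) auto
  qed
  moreover have "c - (\<Sum>i\<in>A. wedge (g i p) (contr (g i p) c)) \<in> chains (rooks g A (B - {p})) (Suc q)"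
    by (rule remove_column_chains[OF b p]) (use c in \<open>simp add: cyc_def\<close>)
  ultimately have "c' \<in> chains (rooks g A (B - {p})) (Suc q)"
    unfolding c'_eq by (intro fs.subspace_add[OF subspace_chains])
  moreover have "bdry c' = 0"
    using c by (simp add: c'_def d.add bdry_bdry cyc_def)
  ultimately have "c' \<in> cyc (rooks g A (B - {p})) (Suc q)" by (simp add: cyc_def)
  moreover have "c - c' = bdry (- e)" by (simp add: c'_def d.neg)
  then have "c - c' \<in> bnd (rooks g A B) (Suc q)"
    using bdry_in_bnd[OF fs.subspace_neg[OF subspace_chains e]] by simp
  ultimately show ?thesis by blast
qed

text \<open>The contractions at the \<open>card A\<close> squares of column \<open>p\<close> land in
  links with at most \<open>N\<close> generators each. Once all of them are boundaries,
  \<open>clear_column\<close> applies.\<close>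

lemma avoid_column:
  assumes b: "board g A B" and p: "p \<in> B"
    and le: "\<And>i. i \<in> A \<Longrightarrow> hom_le (rooks g (A - {i}) (B - {p})) q N"
  shows "\<exists>T. finite T \<and> card T \<le> card A * N \<and> cyc (rooks g A B) (Suc q) \<subseteq>
    fs.span (T \<union> bnd (rooks g A B) (Suc q) \<union> cyc (rooks g A (B - {p})) (Suc q))"
proof -
  let ?K = "rooks g A B" and ?Ki = "\<lambda>i. rooks g (A - {i}) (B - {p})"
  have "\<exists>S. finite S \<and> card S \<le> N \<and> contr (g i p) ` cyc ?K (Suc q) \<subseteq> fs.span (bnd (?Ki i) q \<union> S)"
    if "i \<in> A" for i
  proof -
    have "contr (g i p) ` cyc ?K (Suc q) \<subseteq> cyc (?Ki i) q"
      using contr_cyc[OF b] board_E[OF b that p] by auto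
    then show ?thesis using le[OF that] unfolding hom_le_def by (meson order_trans)
  qed
  from subspace_preimages_generators[where h = "\<lambda>i. contr (g i p)" and U = "\<lambda>i. bnd (?Ki i) q",
      OF board_finite(1)[OF b] linear_contr subspace_cyc this]
  obtain T where T: "finite T" "card T \<le> card A * N" "cyc ?K (Suc q) \<subseteq>
      fs.span (T \<union> {v \<in> cyc ?K (Suc q). \<forall>i\<in>A. contr (g i p) v \<in> fs.span (bnd (?Ki i) q)})"
    by blast
  let ?R = "T \<union> bnd ?K (Suc q) \<union> cyc (rooks g A (B - {p})) (Suc q)"
  have "v \<in> fs.span ?R" if v: "v \<in> cyc ?K (Suc q)" "\<forall>i\<in>A. contr (g i p) v \<in> fs.span (bnd (?Ki i) q)" for v
  proof -
    have sp: "fs.span (bnd (?Ki i) q) = bnd (?Ki i) q" for i by (simp add: subspace_bnd)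
    obtain c' where "c' \<in> cyc (rooks g A (B - {p})) (Suc q)" "v - c' \<in> bnd ?K (Suc q)"
      using clear_column[OF b p v(1)] v(2) unfolding sp by blast
    then have "(v - c') + c' \<in> fs.span ?R" by (intro fs.span_add fs.span_base) auto
    then show ?thesis by simp
  qed
  then have "T \<union> {v \<in> cyc ?K (Suc q). \<forall>i\<in>A. contr (g i p) v \<in> fs.span (bnd (?Ki i) q)} \<subseteq> fs.span ?R"
    by (auto intro: fs.span_base)
  then have "cyc ?K (Suc q) \<subseteq> fs.span ?R"
    using T(3) fs.span_minimal[OF _ fs.subspace_span] by (meson order_trans)
  then show ?thesis using T by blast
qed

lemma avoid_row:
  assumes b: "board g A B" and i: "i \<in> A"
    and le: "\<And>p. p \<in> B \<Longrightarrow> hom_le (rooks g (A - {i}) (B - {p})) q N"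
  shows "\<exists>T. finite T \<and> card T \<le> card B * N \<and> cyc (rooks g A B) (Suc q) \<subseteq>
    fs.span (T \<union> bnd (rooks g A B) (Suc q) \<union> cyc (rooks g (A - {i}) B) (Suc q))"
  using avoid_column[of "\<lambda>i j. g j i" B A i q N] assms
  by (simp add: board_transpose[of g] rooks_transpose[of g])

text \<open>Since row \<open>i\<close> is empty, the part \<open>c0\<close> of \<open>c\<close> off
  column \<open>p\<close> can be coned with apex \<open>ip\<close>. The contractions
  \<open>?z s\<close> are cycles, so the boundary of \<open>c0\<close> is minus their sum, and the
  boundary of the cone is the difference in question.\<close>

lemma row_free_cycle:
  assumes b: "board g A B" and i: "i \<in> A" and p: "p \<in> B"
    and c: "c \<in> cyc (rooks g (A - {i}) B) (Suc q)"
  shows "c - (\<Sum>s\<in>A - {i}. wdiff (g s p) (g i p) (contr (g s p) c)) \<in> bnd (rooks g A B) (Suc q)"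
proof -
  interpret d: module_hom cscale cscale bdry by (rule linear_bdry)
  interpret w: module_hom cscale cscale "wedge (g i p)" by (rule linear_wedge)
  let ?z = "\<lambda>s. contr (g s p) c"
  define c0 where "c0 = c - (\<Sum>s\<in>A - {i}. wedge (g s p) (?z s))"
  have b': "board g (A - {i}) B" using b by (rule board_subset) auto
  have "bdry (wedge (g s p) (?z s)) = ?z s" if "s \<in> A - {i}" for s
  proof -
    interpret v: module_hom cscale cscale "wedge (g s p)" by (rule linear_wedge)
    show ?thesis
      using contr_cyc[OF b' c, of s p] board_E[OF b' that p] by (simp add: bdry_wedge cyc_def)
  qed
  then have bd: "bdry c0 = - (\<Sum>s\<in>A - {i}. ?z s)"
    using c by (simp add: c0_def d.diff d.sum cyc_def)
  have "c0 \<in> chains (rooks g (A - {i}) (B - {p})) (Suc q)"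
    unfolding c0_def using remove_column_chains[OF b' p] c by (simp add: cyc_def)
  then have "wedge (g i p) c0 \<in> chains (rooks g A B) (Suc (Suc q))"
    by (rule wedge_chains[OF b i p]) auto
  moreover have "bdry (wedge (g i p) c0) = c0 + (\<Sum>s\<in>A - {i}. wedge (g i p) (?z s))"
    using board_E[OF b i p] by (simp add: bdry_wedge bd w.neg w.sum)
  then have "bdry (wedge (g i p) c0) = c - (\<Sum>s\<in>A - {i}. wdiff (g s p) (g i p) (?z s))"
    by (simp add: c0_def wdiff_def sum_subtractf)
  ultimately show ?thesis using bdry_in_bnd by metis
qed

section \<open>Spanning sets and the recursion for the number of generators\<close>

lemma row_free_span:
  assumes b: "board g A B" and i: "i \<in> A" and p: "p \<in> B"
    and sub: "\<And>s. s \<in> A - {i} \<Longrightarrow>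
      wdiff (g s p) (g i p) ` cyc (rooks g (A - {i} - {s}) (B - {p})) q \<subseteq> fs.span R"
    and R: "bnd (rooks g A B) (Suc q) \<subseteq> fs.span R"
  shows "cyc (rooks g (A - {i}) B) (Suc q) \<subseteq> fs.span R"
proof
  fix c assume c: "c \<in> cyc (rooks g (A - {i}) B) (Suc q)"
  let ?z = "\<lambda>s. contr (g s p) c"
  have b': "board g (A - {i}) B" using b by (rule board_subset) auto
  have "wdiff (g s p) (g i p) (?z s) \<in> fs.span R" if "s \<in> A - {i}" for s
    using sub[OF that] contr_cyc[OF b' c] board_E[OF b' that p] by blast
  then have "(\<Sum>s\<in>A - {i}. wdiff (g s p) (g i p) (?z s)) \<in> fs.span R"
    by (rule fs.span_sum)
  moreover have "c - (\<Sum>s\<in>A - {i}. wdiff (g s p) (g i p) (?z s)) \<in> fs.span R"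
    using row_free_cycle[OF b i p c] R by blast
  ultimately show "c \<in> fs.span R"
    using fs.span_add by fastforce
qed

lemma wdiff_span:
  assumes "board g A B" "s \<in> A" "i \<in> A" "p \<in> B" "t \<in> B"
    "A' \<subseteq> A - {s, i}" "B' \<subseteq> B - {p, t}"
    and Z: "Z \<subseteq> fs.span (bnd (rooks g A' B') q \<union> G)"
  shows "wdiff (g s p) (g i t) ` Z
    \<subseteq> fs.span (bnd (rooks g A B) (Suc q) \<union> wdiff (g s p) (g i t) ` G)"
proof -
  interpret h: module_hom cscale cscale "wdiff (g s p) (g i t)" by (rule linear_wdiff)
  have "wdiff (g s p) (g i t) ` (bnd (rooks g A' B') q \<union> G)
      \<subseteq> bnd (rooks g A B) (Suc q) \<union> wdiff (g s p) (g i t) ` G"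
    using wdiff_bnd[OF assms(1-5) _ assms(6,7)] by blast
  then have "fs.span (wdiff (g s p) (g i t) ` (bnd (rooks g A' B') q \<union> G))
      \<subseteq> fs.span (bnd (rooks g A B) (Suc q) \<union> wdiff (g s p) (g i t) ` G)"
    by (rule fs.span_mono)
  then show ?thesis using image_mono[OF Z, of "wdiff (g s p) (g i t)"] unfolding h.span_image by blast
qed

text \<open>When the links have no homology in this degree, clearing row \<open>i\<close> costs no
  generators. This case serves the vanishing range and the small boards.\<close>

lemma row_span:
  assumes b: "board g A B" and i: "i \<in> A" and p: "p \<in> B"
    and le: "\<And>u. u \<in> B \<Longrightarrow> hom_le (rooks g (A - {i}) (B - {u})) q 0"
  shows "cyc (rooks g A B) (Suc q) \<subseteq> fs.span (bnd (rooks g A B) (Suc q) \<union>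
    (\<Union>s\<in>A - {i}. wdiff (g s p) (g i p) ` cyc (rooks g (A - {i} - {s}) (B - {p})) q))"
    (is "_ \<subseteq> fs.span ?R")
proof -
  have *: "cyc (rooks g A B) (Suc q) \<subseteq>
      fs.span (bnd (rooks g A B) (Suc q) \<union> cyc (rooks g (A - {i}) B) (Suc q))"
    using avoid_row[OF b i le] by auto
  have "cyc (rooks g (A - {i}) B) (Suc q) \<subseteq> fs.span ?R"
    by (rule row_free_span[OF b i p]) (auto intro: fs.span_base)
  then have "bnd (rooks g A B) (Suc q) \<union> cyc (rooks g (A - {i}) B) (Suc q) \<subseteq> fs.span ?R"
    by (auto intro: fs.span_base)
  from fs.span_minimal[OF this fs.subspace_span] * show ?thesis by blast
qed

text \<open>Modulo boundaries \<open>(sp) z = (it) z\<close> whenever \<open>z\<close> avoids the rows \<open>s, i\<close> and the columns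
  \<open>p, t\<close>. So if \<open>z\<close> avoids column \<open>t\<close>, the class \<open>(sp - ip) z\<close> equals \<open>(it - ip) z\<close>, in which
  the row \<open>s\<close> no longer appears: all \<open>s\<close> share one set of generators.\<close>

lemma cyc_generators:
  assumes b: "board g A B" and i: "i \<in> A" and pt: "p \<in> B" "t \<in> B" "p \<noteq> t"
    and le1: "\<And>s j. s \<in> A - {i} \<Longrightarrow> j \<in> A - {i} - {s} \<Longrightarrow>
      hom_le (rooks g (A - {i} - {s} - {j}) (B - {p} - {t})) q N1"
    and le2: "\<And>u. u \<in> B \<Longrightarrow> hom_le (rooks g (A - {i}) (B - {u})) (Suc q) N2"
    and cA: "card A = Suc a"
  shows "\<exists>W. finite W \<and> card W \<le> a * ((a - 1) * N1) + card B * N2 \<and>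
    cyc (rooks g A B) (Suc (Suc q)) \<subseteq> fs.span (bnd (rooks g A B) (Suc (Suc q)) \<union>
      wdiff (g i t) (g i p) ` cyc (rooks g (A - {i}) (B - {p} - {t})) (Suc q) \<union> W)"
proof -
  let ?K = "rooks g A B" and ?Z = "cyc (rooks g (A - {i}) (B - {p} - {t})) (Suc q)"
  obtain T where T: "finite T" "card T \<le> card B * N2" "cyc ?K (Suc (Suc q)) \<subseteq>
      fs.span (T \<union> bnd ?K (Suc (Suc q)) \<union> cyc (rooks g (A - {i}) B) (Suc (Suc q)))"
    using avoid_row[OF b i le2] by blast
  \<comment> \<open>Besides \<open>i\<close> and \<open>s\<close> there are \<open>a - 1\<close>
    rows, and the square of column \<open>t\<close> in each of them costs at most \<open>N1\<close>
    generators.\<close>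
  have "\<exists>S. finite S \<and> card S \<le> (a - 1) * N1 \<and> cyc (rooks g (A - {i} - {s}) (B - {p})) (Suc q) \<subseteq>
      fs.span (S \<union> bnd (rooks g (A - {i} - {s}) (B - {p})) (Suc q)
        \<union> cyc (rooks g (A - {i} - {s}) (B - {p} - {t})) (Suc q))"
    if s: "s \<in> A - {i}" for s
  proof -
    have b': "board g (A - {i} - {s}) (B - {p})" using b by (rule board_subset) auto
    have "card (A - {i} - {s}) = a - 1"
      using s i cA by simp
    then show ?thesis using avoid_column[OF b' _ le1[OF s]] pt by auto
  qed
  then obtain S where S: "\<And>s. s \<in> A - {i} \<Longrightarrow> finite (S s) \<and> card (S s) \<le> (a - 1) * N1 \<and>
      cyc (rooks g (A - {i} - {s}) (B - {p})) (Suc q) \<subseteq>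
      fs.span (S s \<union> bnd (rooks g (A - {i} - {s}) (B - {p})) (Suc q)
        \<union> cyc (rooks g (A - {i} - {s}) (B - {p} - {t})) (Suc q))"
    by metis
  define W where "W = (\<Union>s\<in>A - {i}. wdiff (g s p) (g i p) ` S s)"
  have fin: "finite A" using board_finite[OF b] by simp
  have "finite W" unfolding W_def using fin S by auto
  have "card W \<le> (\<Sum>s\<in>A - {i}. card (wdiff (g s p) (g i p) ` S s))"
    unfolding W_def by (rule card_UN_le) (use fin in simp)
  also have "\<dots> \<le> (\<Sum>s\<in>A - {i}. (a - 1) * N1)"
    by (rule sum_mono) (use S card_image_le le_trans in blast)
  also have "\<dots> = a * ((a - 1) * N1)" using cA i by simp
  finally have cW: "card W \<le> a * ((a - 1) * N1)" .
  define R where "R = bnd ?K (Suc (Suc q)) \<union> wdiff (g i t) (g i p) ` ?Z \<union> (W \<union> T)"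
  have bnd_R: "bnd ?K (Suc (Suc q)) \<subseteq> fs.span R"
    unfolding R_def by (auto intro: fs.span_base)
  have "cyc (rooks g (A - {i}) B) (Suc (Suc q)) \<subseteq> fs.span R"
  proof (rule row_free_span[OF b i pt(1) _ bnd_R])
    fix s assume s: "s \<in> A - {i}"
    interpret h: module_hom cscale cscale "wdiff (g s p) (g i p)" by (rule linear_wdiff)
    have "wdiff (g s p) (g i p) z \<in> fs.span R"
      if z: "z \<in> cyc (rooks g (A - {i} - {s}) (B - {p} - {t})) (Suc q)" for z
    proof -
      have "wdiff (g s p) (g i t) z \<in> bnd ?K (Suc (Suc q))"
        by (rule wedge_move[OF b _ i _ pt z]) (use s in auto)
      moreover have "z \<in> ?Z"
        by (rule subsetD[OF cyc_mono z], rule rooks_mono) auto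
      then have "wdiff (g i t) (g i p) z \<in> fs.span R"
        by (intro fs.span_base) (auto simp: R_def)
      \<comment> \<open>Telescoping: \<open>(sp - ip) z = (sp - it) z + (it - ip) z\<close>.\<close>
      ultimately have "wdiff (g s p) (g i t) z + wdiff (g i t) (g i p) z \<in> fs.span R"
        using bnd_R by (intro fs.span_add) auto
      then show ?thesis by (simp add: wdiff_def)
    qed
    moreover have "wdiff (g s p) (g i p) z \<in> fs.span R"
      if z: "z \<in> bnd (rooks g (A - {i} - {s}) (B - {p})) (Suc q)" for z
      using wdiff_bnd[OF b _ i pt(1) pt(1) z] s bnd_R by auto
    moreover have "wdiff (g s p) (g i p) z \<in> fs.span R" if "z \<in> S s" for z
      using that s by (intro fs.span_base) (auto simp: R_def W_def)
    ultimately have "wdiff (g s p) (g i p) ` (S s \<union> bnd (rooks g (A - {i} - {s}) (B - {p})) (Suc q)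
        \<union> cyc (rooks g (A - {i} - {s}) (B - {p} - {t})) (Suc q)) \<subseteq> fs.span R" by blast
    from fs.span_minimal[OF this fs.subspace_span]
    show "wdiff (g s p) (g i p) ` cyc (rooks g (A - {i} - {s}) (B - {p})) (Suc q) \<subseteq> fs.span R"
      unfolding h.span_image using S[OF s] by blast
  qed
  then have "T \<union> bnd ?K (Suc (Suc q)) \<union> cyc (rooks g (A - {i}) B) (Suc (Suc q)) \<subseteq> fs.span R"
    using bnd_R by (auto simp: R_def intro: fs.span_base)
  from fs.span_minimal[OF this fs.subspace_span] T(3) have "cyc ?K (Suc (Suc q)) \<subseteq> fs.span R"
    by blast
  moreover have "card (W \<union> T) \<le> a * ((a - 1) * N1) + card B * N2"
    using card_Un_le[of W T] cW T by linarith
  ultimately show ?thesis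
    unfolding R_def using \<open>finite W\<close> T by (intro exI[of _ "W \<union> T"]) auto
qed

text \<open>\<open>cyc_generators\<close> leaves the image of the cycles on the board without row
  \<open>i\<close> and columns \<open>p\<close>, \<open>t\<close>. As \<open>wdiff\<close> sends
  boundaries to boundaries, \<open>N0\<close> generators suffice for that image.\<close>

lemma hom_le_recursion:
  assumes b: "board g A B" and i: "i \<in> A" and pt: "p \<in> B" "t \<in> B" "p \<noteq> t"
    and le0: "hom_le (rooks g (A - {i}) (B - {p} - {t})) (Suc q) N0"
    and le1: "\<And>s j. s \<in> A - {i} \<Longrightarrow> j \<in> A - {i} - {s} \<Longrightarrow>
      hom_le (rooks g (A - {i} - {s} - {j}) (B - {p} - {t})) q N1"
    and le2: "\<And>u. u \<in> B \<Longrightarrow> hom_le (rooks g (A - {i}) (B - {u})) (Suc q) N2"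
    and cA: "card A = Suc a"
  shows "hom_le (rooks g A B) (Suc (Suc q)) (N0 + a * ((a - 1) * N1) + card B * N2)"
proof -
  let ?Z = "cyc (rooks g (A - {i}) (B - {p} - {t})) (Suc q)"
  let ?B = "bnd (rooks g A B) (Suc (Suc q))"
  obtain W where W: "finite W" "card W \<le> a * ((a - 1) * N1) + card B * N2"
    "cyc (rooks g A B) (Suc (Suc q)) \<subseteq> fs.span (?B \<union> wdiff (g i t) (g i p) ` ?Z \<union> W)"
    using cyc_generators[OF b i pt le1 le2 cA] by blast
  obtain S where S: "finite S" "card S \<le> N0"
    "?Z \<subseteq> fs.span (bnd (rooks g (A - {i}) (B - {p} - {t})) (Suc q) \<union> S)"
    using le0 by (auto simp: hom_le_def)
  define V where "V = wdiff (g i t) (g i p) ` S"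
  have "wdiff (g i t) (g i p) ` ?Z \<subseteq> fs.span (?B \<union> V)"
    unfolding V_def by (rule wdiff_span[OF b i i pt(2,1) _ _ S(3)]) auto
  also have "\<dots> \<subseteq> fs.span (?B \<union> (V \<union> W))" by (rule fs.span_mono) auto
  finally have "?B \<union> wdiff (g i t) (g i p) ` ?Z \<union> W \<subseteq> fs.span (?B \<union> (V \<union> W))"
    by (auto intro: fs.span_base)
  from fs.span_minimal[OF this fs.subspace_span] W(3)
  have "cyc (rooks g A B) (Suc (Suc q)) \<subseteq> fs.span (?B \<union> (V \<union> W))" by blast
  moreover have "card V \<le> N0" "finite V"
    using S card_image_le[OF S(1), of "wdiff (g i t) (g i p)"] by (auto simp: V_def)
  moreover from this have "card (V \<union> W) \<le> N0 + a * ((a - 1) * N1) + card B * N2"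
    using card_Un_le[of V W] W by linarith
  ultimately show ?thesis
    unfolding hom_le_def using W by (intro exI[of _ "V \<union> W"]) auto
qed

text \<open>The factor \<open>(m + 2) * (m + 1)\<close> counts the ordered pairs of rows
  \<open>s\<close>, \<open>j\<close> other than \<open>i\<close>. Sizes are written as sums to keep
  truncated subtraction out.\<close>

lemma board_le_recursion:
  assumes le0: "board_le (m + 2) n (Suc q) N0" and le1: "board_le m n q N1"
    and le2: "board_le (m + 2) (n + 1) (Suc q) N2"
  shows "board_le (m + 3) (n + 2) (Suc (Suc q)) (N0 + (m + 2) * ((m + 1) * N1) + (n + 2) * N2)"
  unfolding board_le_def
proof (intro allI impI)
  fix g A B assume b: "board g A B" and cA: "card A = m + 3" and cB: "card B = n + 2"
  obtain i where i: "i \<in> A" using cA by (metis card.empty ex_in_conv add_is_0 zero_neq_numeral)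
  have "\<exists>p t. p \<in> B \<and> t \<in> B \<and> p \<noteq> t"
    using cB card_le_Suc0_iff_eq[OF board_finite(2)[OF b]] by fastforce
  then obtain p t where pt: "p \<in> B" "t \<in> B" "p \<noteq> t" by blast
  have sub: "board g A' B'" if "A' \<subseteq> A" "B' \<subseteq> B" for A' B' using board_subset[OF b that] .
  have "hom_le (rooks g A B) (Suc (Suc q)) (N0 + (m + 2) * ((m + 2 - 1) * N1) + card B * N2)"
  proof (rule hom_le_recursion[OF b i pt])
    show "hom_le (rooks g (A - {i}) (B - {p} - {t})) (Suc q) N0"
      by (rule board_leD[OF le0 sub]) (use i pt cA cB in auto)
    show "hom_le (rooks g (A - {i} - {s} - {j}) (B - {p} - {t})) q N1"
      if "s \<in> A - {i}" "j \<in> A - {i} - {s}" for s j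
      by (rule board_leD[OF le1 sub]) (use that i pt cA cB in auto)
    show "hom_le (rooks g (A - {i}) (B - {u})) (Suc q) N2" if "u \<in> B" for u
      by (rule board_leD[OF le2 sub]) (use that i cA cB in auto)
  qed (use cA in simp)
  then show "hom_le (rooks g A B) (Suc (Suc q)) (N0 + (m + 2) * ((m + 1) * N1) + (n + 2) * N2)"
    by (simp add: cB)
qed

section \<open>The vanishing range and a crude bound\<close>

lemma board_le_0_step:
  assumes le1: "board_le (m + 1) n q 0" and le2: "board_le m n q 0"
  shows "board_le (m + 2) (n + 1) (Suc q) 0"
  unfolding board_le_def
proof (intro allI impI)
  fix g A B assume b: "board g A B" and cA: "card A = m + 2" and cB: "card B = n + 1"
  let ?K = "rooks g A B"
  obtain i where i: "i \<in> A" using cA by (metis card.empty ex_in_conv add_is_0 zero_neq_numeral)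
  obtain p where p: "p \<in> B" using cB by (metis card.empty ex_in_conv add_is_0 zero_neq_one)
  have sub: "board g A' B'" if "A' \<subseteq> A" "B' \<subseteq> B" for A' B' using board_subset[OF b that] .
  \<comment> \<open>The links of the squares in row \<open>i\<close> have size \<open>m + 1\<close>
    by \<open>n\<close> and contribute nothing by \<open>le1\<close>. What remains are edge
    differences times cycles on \<open>m\<close> by \<open>n\<close> boards, and these bound by
    \<open>le2\<close>.\<close>
  have "hom_le (rooks g (A - {i}) (B - {u})) q 0" if "u \<in> B" for u
    by (rule board_leD[OF le1 sub]) (use that i cA cB in auto)
  note span = row_span[OF b i p this]
  have "(\<Union>s\<in>A - {i}. wdiff (g s p) (g i p) ` cyc (rooks g (A - {i} - {s}) (B - {p})) q)
      \<subseteq> bnd ?K (Suc q)"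
  proof (intro UN_least)
    fix s assume s: "s \<in> A - {i}"
    have "hom_le (rooks g (A - {i} - {s}) (B - {p})) q 0"
      by (rule board_leD[OF le2 sub]) (use s p i cA cB in auto)
    then have "cyc (rooks g (A - {i} - {s}) (B - {p})) q \<subseteq> bnd (rooks g (A - {i} - {s}) (B - {p})) q"
      by (simp add: hom_le_0)
    moreover have "wdiff (g s p) (g i p) z \<in> bnd ?K (Suc q)"
      if "z \<in> bnd (rooks g (A - {i} - {s}) (B - {p})) q" for z
      using wdiff_bnd[OF b _ i p p that] s by auto
    ultimately show "wdiff (g s p) (g i p) ` cyc (rooks g (A - {i} - {s}) (B - {p})) q \<subseteq> bnd ?K (Suc q)"
      by blast
  qed
  then show "hom_le ?K (Suc q) 0"
    using span unfolding hom_le_def by (intro exI[of _ "{}"]) (simp add: Un_absorb2)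
qed

text \<open>The classical connectivity range: with \<open>d = q - 1\<close> the hypotheses say that
  \<open>d + 2\<close> is at most \<open>m\<close>, \<open>n\<close> and
  \<open>(m + n + 1) / 3\<close>. The induction strips two rows and one column, or one row and two
  columns if rows are scarce.\<close>

lemma board_le_0:
  assumes "3 * q + 2 \<le> m + n" "q + 1 \<le> m" "q + 1 \<le> n"
  shows "board_le m n q 0"
  using assms
proof (induction q arbitrary: m n)
  case 0
  show ?case
    unfolding board_le_def hom_le_0
  proof (intro allI impI subsetI)
    fix g A B c assume b: "board g A B" and card: "card A = m" "card B = n"
      and c: "c \<in> cyc (rooks g A B) 0"
    obtain i where i: "i \<in> A" using card 0 by fastforce
    obtain p where p: "p \<in> B" using card 0 by fastforce
    interpret w: module_hom cscale cscale "wedge (g i p)" by (rule linear_wedge)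
    have "c \<in> chains (rooks g (A - {i}) (B - {p})) 0"
      using c chains_0[OF b] by (auto simp: cyc_def)
    then have "wedge (g i p) c \<in> chains (rooks g A B) (Suc 0)"
      by (rule wedge_chains[OF b i p]) auto
    moreover have "bdry (wedge (g i p) c) = c"
      using c board_E[OF b i p] by (simp add: bdry_wedge cyc_def)
    ultimately show "c \<in> bnd (rooks g A B) 0" using bdry_in_bnd by metis
  qed
next
  case (Suc q)
  show ?case
  proof (cases "q + 3 \<le> m")
    case True
    define m' n' where "m' = m - 2" and "n' = n - 1"
    have mn: "m = m' + 2" "n = n' + 1" using True Suc.prems by (auto simp: m'_def n'_def)
    show ?thesis
      unfolding mn by (intro board_le_0_step Suc.IH) (use True Suc.prems mn in auto)
  next
    case False
    \<comment> \<open>Here \<open>m = q + 2\<close>, so \<open>n \<ge> 2 * q + 3\<close> leaves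
      enough columns to strip two.\<close>
    define m' n' where "m' = m - 1" and "n' = n - 2"
    have mn: "m = m' + 1" "n = n' + 2" using False Suc.prems by (auto simp: m'_def n'_def)
    show ?thesis
      unfolding mn
      by (intro board_le_transpose[OF board_le_0_step] Suc.IH) (use False Suc.prems mn in auto)
  qed
qed

text \<open>Single faces span the chains, and a face is a set of squares. Any bound uniform over
  boards of one size would do: it starts the recursion at \<open>(k, 0, k + 2)\<close>.\<close>

lemma board_le_finite: "board_le m n q (2 ^ (m * n))"
  unfolding board_le_def
proof (intro allI impI)
  fix g A B assume b: "board g A B" and card: "card A = m" "card B = n"
  let ?K = "rooks g A B"
  let ?e = "\<lambda>\<sigma> \<tau>. if \<tau> = \<sigma> then 1 else 0 :: 'f"
  have "?K \<subseteq> Pow ((\<lambda>(i, j). g i j) ` (A \<times> B))" unfolding rooks_def by auto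
  moreover have fin: "finite (A \<times> B)" using board_finite[OF b] by simp
  then have "finite (Pow ((\<lambda>(i, j). g i j) ` (A \<times> B)))" by simp
  ultimately have K: "finite ?K" "card ?K \<le> card (Pow ((\<lambda>(i, j). g i j) ` (A \<times> B)))"
    by (rule finite_subset, intro card_mono)
  have "card ((\<lambda>(i, j). g i j) ` (A \<times> B)) \<le> m * n"
    using card_image_le[OF fin, of "\<lambda>(i, j). g i j"] card by (simp add: card_cartesian_product)
  then have "card ?K \<le> 2 ^ (m * n)" using K(2) fin
    by (simp add: card_Pow) (meson le_trans one_le_numeral power_increasing)
  moreover have "card (?e ` ?K) \<le> card ?K" using K(1) by (rule card_image_le)
  moreover have "c \<in> fs.span (?e ` ?K)" if "c \<in> cyc ?K q" for c
  proof -
    have "c = (\<Sum>\<sigma>\<in>?K. cscale (c \<sigma>) (?e \<sigma>))"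
    proof
      fix \<tau>
      have "(\<Sum>\<sigma>\<in>?K. cscale (c \<sigma>) (?e \<sigma>)) \<tau> = (\<Sum>\<sigma>\<in>?K. if \<sigma> = \<tau> then c \<sigma> else 0)"
        unfolding sum_fun_apply by (rule sum.cong) (auto simp: cscale_apply)
      also have "\<dots> = c \<tau>" using that K(1) by (auto simp: cyc_def chains_def)
      finally show "c \<tau> = (\<Sum>\<sigma>\<in>?K. cscale (c \<sigma>) (?e \<sigma>)) \<tau>" ..
    qed
    also have "\<dots> \<in> fs.span (?e ` ?K)"
      by (intro fs.span_sum fs.span_scale fs.span_base) auto
    finally show ?thesis .
  qed
  then have "cyc ?K q \<subseteq> fs.span (bnd ?K q \<union> ?e ` ?K)"
    using fs.span_mono[of "?e ` ?K" "bnd ?K q \<union> ?e ` ?K"] by auto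
  ultimately show "hom_le ?K q (2 ^ (m * n))"
    unfolding hom_le_def using K(1) by (intro exI[of _ "?e ` ?K"]) auto
qed

end

section \<open>The case m = n = 5, d = 2\<close>

context chain_operators
begin

text \<open>The empty face as a cycle of dimension -1; products of edges are operators applied to
  it.\<close>

definition unit_chain :: "'v set \<Rightarrow> 'f" where
  "unit_chain = (\<lambda>\<sigma>. if \<sigma> = {} then 1 else 0)"

lemma unit_chain_cyc: "unit_chain \<in> cyc (rooks g A B) 0"
proof -
  have "contr v unit_chain = 0" for v by (auto simp: contr_def unit_chain_def)
  then have "bdry unit_chain = 0" by (simp add: bdry_def)
  then show ?thesis by (auto simp: cyc_def chains_def unit_chain_def rooks_def)
qed

lemma chains_0_span:
  assumes "board g A B"
  shows "chains (rooks g A B) 0 \<subseteq> fs.span {unit_chain}"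
proof
  fix c assume c: "c \<in> chains (rooks g A B) 0"
  have "c \<sigma> = 0" if "\<sigma> \<noteq> {}" for \<sigma>
    using c finite_rook[OF assms, of \<sigma>] that by (auto simp: chains_def)
  then have "c = cscale (c {}) unit_chain"
    by (auto simp: cscale_def unit_chain_def fun_eq_iff)
  then show "c \<in> fs.span {unit_chain}"
    using fs.span_scale[OF fs.span_base[of unit_chain "{unit_chain}"], of "c {}"] by simp
qed

lemma wdiff_anticommute:
  assumes "u \<in> E" "v \<in> E" "u' \<in> E" "v' \<in> E"
  shows "wdiff u v (wdiff u' v' z) = - wdiff u' v' (wdiff u v z)"
proof -
  interpret w: module_hom cscale cscale "wedge v" for v by (rule linear_wedge)
  have ac: "wedge a (wedge b z) = - wedge b (wedge a z)" if "a \<in> E" "b \<in> E" for a b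
    using wedge_wedge[OF that, of z] wedge_wedge[OF that(1) that(1), of z] by (cases "a = b") auto
  note eqs = ac[OF assms(1,3)] ac[OF assms(1,4)] ac[OF assms(2,3)] ac[OF assms(2,4)]
  show ?thesis
    unfolding wdiff_def w.diff eqs by (simp add: algebra_simps)
qed

text \<open>Interchanging the rows \<open>s\<close> and \<open>l\<close> changes the sign of the class. The two products of edge
  differences are moved to \<open>(sx - sv) y\<close> and \<open>(lx - lv) y\<close> with a common cycle \<open>y\<close> avoiding
  both rows; \<open>\<eta>\<close> is a path from \<open>(o1,p)\<close> to \<open>(o1,t)\<close> in the remaining rows.\<close>

lemma five_board_antisymmetry:
  assumes b: "board g A B" and A: "A = {o1, i, s, l, l'}" "distinct [o1, i, s, l, l']"
    and B: "B = {t, p, x, u, v}" "distinct [t, p, x, u, v]"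
  defines "cls \<equiv> \<lambda>s l. wdiff (g o1 t) (g o1 p) (wdiff (g s x) (g i x)
    (wdiff (g l' u) (g l u) unit_chain))"
  shows "cls s l + cls l s \<in> bnd (rooks g A B) 3"
proof -
  interpret w: module_hom cscale cscale "wedge a" for a by (rule linear_wedge)
  interpret wd: module_hom cscale cscale "wdiff a c" for a c by (rule linear_wdiff)
  interpret d: module_hom cscale cscale bdry by (rule linear_bdry)
  note mem = board_E[OF b]
  have sub: "board g A' B'" if "A' \<subseteq> A" "B' \<subseteq> B" for A' B' using board_subset[OF b that] .
  let ?K = "rooks g A B"
  define D where "D = wdiff (g o1 t) (g o1 p) unit_chain"
  \<comment> \<open>The path visits \<open>o1 p\<close>, \<open>l' t\<close>, \<open>i p\<close>,
    \<open>o1 t\<close>, of which consecutive ones do not attack each other; its boundary is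
    \<open>D\<close>.\<close>
  define \<eta> where "\<eta> = wedge (g i p) (wedge (g o1 t) unit_chain)
    + wedge (g l' t) (wedge (g i p) unit_chain) + wedge (g o1 p) (wedge (g l' t) unit_chain)"
  \<comment> \<open>Both \<open>wedge (g l' u) D\<close> and \<open>\<eta>\<close> have boundary
    \<open>D\<close>. Their difference is a cycle involving neither \<open>s\<close> nor
    \<open>l\<close>, hence common to both classes.\<close>
  define y where "y = wedge (g l' u) D - \<eta>"
  have D: "D \<in> cyc (rooks g {o1} {t, p}) 1"
    unfolding D_def One_nat_def
    by (rule wdiff_cyc[OF sub _ _ _ _ unit_chain_cyc[of g "{}" "{}"]]) (use A B in auto)
  have w1: "wedge (g a c) unit_chain \<in> chains (rooks g {a} {c}) (Suc 0)" if "a \<in> A" "c \<in> B" for a c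
    by (rule wedge_chains[OF sub]) (use that unit_chain_cyc[of g "{}" "{}"] in \<open>auto simp: cyc_def\<close>)
  have w2: "wedge (g a c) (wedge (g a' c') unit_chain) \<in> chains (rooks g {o1, i, l'} {t, p}) 2"
    if "a \<in> {o1, i, l'}" "c \<in> {t, p}" "a' \<in> {o1, i, l'} - {a}" "c' \<in> {t, p} - {c}" for a c a' c'
    unfolding numeral_2_eq_2
    by (rule wedge_chains[OF sub _ _ w1]) (use that A B in auto)
  have \<eta>: "\<eta> \<in> chains (rooks g {o1, i, l'} {t, p}) 2"
    unfolding \<eta>_def by (intro fs.subspace_add[OF subspace_chains] w2) (use A B in auto)
  have bdry_\<eta>: "bdry \<eta> = D"
    using unit_chain_cyc[of g A B] A B
    by (simp add: \<eta>_def D_def wdiff_def d.add bdry_wedge mem cyc_def)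
  have y: "y \<in> cyc (rooks g {o1, i, l'} {t, p, u}) 2"
  proof -
    have "wedge (g l' u) D \<in> chains (rooks g {o1, i, l'} {t, p, u}) (Suc 1)"
      by (rule wedge_chains[OF sub]) (use D A B in \<open>auto simp: cyc_def\<close>)
    moreover have "\<eta> \<in> chains (rooks g {o1, i, l'} {t, p, u}) 2"
      by (rule subsetD[OF chains_mono \<eta>], rule rooks_mono) auto
    ultimately have "y \<in> chains (rooks g {o1, i, l'} {t, p, u}) 2"
      unfolding y_def by (intro fs.subspace_diff[OF subspace_chains]) (simp_all add: numeral_2_eq_2)
    moreover have "bdry y = 0"
      using D A B by (simp add: y_def d.diff bdry_wedge mem bdry_\<eta> cyc_def)
    ultimately show ?thesis by (simp add: cyc_def)
  qed
  have reduce: "cls s l - wdiff (g s x) (g s v) y \<in> bnd ?K 3"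
    if sl: "A = {o1, i, s, l, l'}" "distinct [o1, i, s, l, l']" for s l
  proof -
    define Y where "Y = wdiff (g l' u) (g l u) D"
    have "Y \<in> cyc (rooks g {o1, l', l} {t, p, u}) (Suc 1)"
      unfolding Y_def by (rule wdiff_cyc[OF sub _ _ _ _ D]) (use sl B in auto)
    then have Y: "Y \<in> cyc (rooks g {o1, l', l} {t, p, u}) 2" by (simp add: numeral_2_eq_2)
    \<comment> \<open>Moving the factor of \<open>D\<close> innermost passes two other factors, so
      the signs cancel.\<close>
    have cls: "cls s l = wdiff (g s x) (g i x) Y"
      using sl B by (simp add: cls_def Y_def D_def wdiff_anticommute[of "g o1 t" "g o1 p"] mem wd.neg)
    \<comment> \<open>\<open>Y\<close> avoids the rows \<open>i\<close>, \<open>s\<close> and the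
      columns \<open>x\<close>, \<open>v\<close>, so \<open>(ix) Y\<close> may be exchanged for
      \<open>(sv) Y\<close>.\<close>
    have move: "wdiff (g i x) (g s v) Y \<in> bnd ?K (Suc 2)"
      by (rule wedge_move[OF b _ _ _ _ _ _ Y]) (use sl B in auto)
    \<comment> \<open>Coning \<open>\<eta>\<close> with apex \<open>lu\<close> makes
      \<open>Y\<close> and \<open>y\<close> homologous away from row \<open>s\<close> and columns
      \<open>x\<close>, \<open>v\<close>, so the factor \<open>sx - sv\<close> may be applied to
      their difference.\<close>
    have "wedge (g l u) \<eta> \<in> chains (rooks g {o1, i, l', l} {t, p, u}) (Suc 2)"
      by (rule wedge_chains[OF sub _ _ \<eta>]) (use sl B in auto)
    moreover have "bdry (wedge (g l u) \<eta>) = Y - y"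
      using sl B by (simp add: Y_def y_def wdiff_def bdry_wedge mem bdry_\<eta>)
    ultimately have Yy: "Y - y \<in> bnd (rooks g {o1, i, l', l} {t, p, u}) 2"
      using bdry_in_bnd by metis
    have "wdiff (g s x) (g s v) (Y - y) \<in> bnd ?K (Suc 2)"
      by (rule wdiff_bnd[OF b _ _ _ _ Yy]) (use sl B in auto)
    then have "wdiff (g s x) (g s v) (Y - y) - wdiff (g i x) (g s v) Y \<in> bnd ?K (Suc 2)"
      using move by (intro fs.subspace_diff[OF subspace_bnd])
    moreover have "wdiff (g s x) (g s v) (Y - y) - wdiff (g i x) (g s v) Y
        = cls s l - wdiff (g s x) (g s v) y"
      unfolding cls wd.diff by (simp add: wdiff_def)
    ultimately show ?thesis by (simp add: numeral_3_eq_3)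
  qed
  \<comment> \<open>\<open>(sx - sv) y + (lx - lv) y = (sx - lv) y + (lx - sv) y\<close>, and both
    terms on the right bound because \<open>y\<close> avoids the rows \<open>s\<close>,
    \<open>l\<close> and the columns \<open>x\<close>, \<open>v\<close>.\<close>
  have "wdiff (g s x) (g l v) y \<in> bnd ?K (Suc 2)" "wdiff (g l x) (g s v) y \<in> bnd ?K (Suc 2)"
    by (rule wedge_move[OF b _ _ _ _ _ _ y]; use A B in auto)+
  moreover have "A = {o1, i, l, s, l'}" using A by auto
  ultimately have "(cls s l - wdiff (g s x) (g s v) y) + (cls l s - wdiff (g l x) (g l v) y)
      + (wdiff (g s x) (g l v) y + wdiff (g l x) (g s v) y) \<in> bnd ?K 3"
    using A by (intro fs.subspace_add[OF subspace_bnd] reduce) (auto simp: numeral_3_eq_3)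
  then show ?thesis by (simp add: wdiff_def algebra_simps)
qed

text \<open>The complex of a 2 by 2 board is two disjoint edges, so its reduced \<open>H_0\<close>
  has dimension one. Two squares of one column lie in different components, and their difference
  generates.\<close>

lemma two_board_span:
  assumes b: "board g A B" and A: "A = {l, l'}" "l \<noteq> l'" and B: "card B = 2" "u \<in> B"
  shows "cyc (rooks g A B) 1 \<subseteq> fs.span (bnd (rooks g A B) 1 \<union> {wdiff (g l' u) (g l u) unit_chain})"
proof -
  have sub: "board g A' B'" if "A' \<subseteq> A" "B' \<subseteq> B" for A' B' using board_subset[OF b that] .
  have "hom_le (rooks g (A - {l}) (B - {w})) 0 0" if "w \<in> B" for w
    by (rule board_leD[OF board_le_0[of 0 1 1] sub]) (use A B that in auto)
  from row_span[OF b _ B(2) this]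
  have "cyc (rooks g A B) 1 \<subseteq> fs.span (bnd (rooks g A B) 1 \<union>
      wdiff (g l' u) (g l u) ` cyc (rooks g (A - {l} - {l'}) (B - {u})) 0)"
    using A by (simp add: insert_Diff_if)
  moreover have "wdiff (g l' u) (g l u) ` cyc (rooks g (A - {l} - {l'}) (B - {u})) 0 \<subseteq>
      fs.span (bnd (rooks g A B) (Suc 0) \<union> wdiff (g l' u) (g l u) ` {unit_chain})"
  proof (rule wdiff_span[OF b, of _ _ _ _ "A - {l} - {l'}" "B - {u}"])
    have "chains (rooks g (A - {l} - {l'}) (B - {u})) 0 \<subseteq> fs.span {unit_chain}"
      by (rule chains_0_span[OF sub]) auto
    also have "\<dots> \<subseteq> fs.span (bnd (rooks g (A - {l} - {l'}) (B - {u})) 0 \<union> {unit_chain})"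
      by (rule fs.span_mono) auto
    finally show "cyc (rooks g (A - {l} - {l'}) (B - {u})) 0 \<subseteq>
        fs.span (bnd (rooks g (A - {l} - {l'}) (B - {u})) 0 \<union> {unit_chain})"
      by (auto simp: cyc_def)
  qed (use A B in auto)
  ultimately have "bnd (rooks g A B) 1 \<union> wdiff (g l' u) (g l u) ` cyc (rooks g (A - {l} - {l'}) (B - {u})) 0
      \<subseteq> fs.span (bnd (rooks g A B) 1 \<union> {wdiff (g l' u) (g l u) unit_chain})"
    by (auto intro: fs.span_base)
  from fs.span_minimal[OF this fs.subspace_span]
  show ?thesis using \<open>cyc (rooks g A B) 1 \<subseteq> _\<close> by blast
qed

text \<open>Two reductions, to a 4 by 3 and then to a 2 by 2 board, leave three products of edge
  differences, one for each choice of the row \<open>s\<close>. Exchanging rows identifies them up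
  to sign.\<close>

lemma board_le_5_5: "board_le 5 5 3 1"
  unfolding board_le_def
proof (intro allI impI)
  fix g A B assume b: "board g A B" and cA: "card A = 5" and cB: "card B = 5"
  let ?K = "rooks g A B"
  have "\<exists>xs. set xs = X \<and> distinct xs \<and> length xs = 5" if "card X = 5" for X :: "nat set"
    using finite_distinct_list[of X] that card_ge_0_finite[of X] by (metis distinct_card zero_less_numeral)
  then have ex: "\<exists>a1 a2 a3 a4 a5. X = {a1, a2, a3, a4, a5} \<and> distinct [a1, a2, a3, a4, a5]"
    if "card X = 5" for X :: "nat set"
    using that by (fastforce simp: length_Suc_conv numeral_eq_Suc)
  obtain o1 i s1 s2 s3 where A: "A = {o1, i, s1, s2, s3}" "distinct [o1, i, s1, s2, s3]"
    using ex[OF cA] by blast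
  obtain t p x u v where B: "B = {t, p, x, u, v}" "distinct [t, p, x, u, v]"
    using ex[OF cB] by blast
  have sub: "board g A' B'" if "A' \<subseteq> A" "B' \<subseteq> B" for A' B' using board_subset[OF b that] .
  define cls where "cls = (\<lambda>s l' l. wdiff (g o1 t) (g o1 p) (wdiff (g s x) (g i x)
    (wdiff (g l' u) (g l u) unit_chain)))"
  let ?A' = "A - {o1}" and ?B' = "B - {p} - {t}"
  have b': "board g ?A' ?B'" by (rule sub) auto
  \<comment> \<open>The links, of sizes 2 by 3 with \<open>q = 1\<close> and 4 by 4 with
    \<open>q = 2\<close>, satisfy \<open>3 * q + 2 = m + n\<close> and just lie in the vanishing
    range, so the clearing is free.\<close>
  have "\<exists>W. finite W \<and> card W \<le> 4 * ((4 - 1) * 0) + card B * 0 \<and>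
    cyc ?K (Suc (Suc 1)) \<subseteq> fs.span (bnd ?K (Suc (Suc 1)) \<union>
      wdiff (g o1 t) (g o1 p) ` cyc (rooks g ?A' ?B') (Suc 1) \<union> W)"
  proof (rule cyc_generators[OF b])
    show "hom_le (rooks g (A - {o1} - {s} - {j}) (B - {p} - {t})) 1 0"
      if "s \<in> A - {o1}" "j \<in> A - {o1} - {s}" for s j
      by (rule board_leD[OF board_le_0[of 1 2 3] sub]) (use that A B cA cB in auto)
    show "hom_le (rooks g (A - {o1}) (B - {w})) (Suc 1) 0" if "w \<in> B" for w
      by (rule board_leD[OF board_le_0[of "Suc 1" 4 4] sub]) (use that A cA cB in auto)
  qed (use A B cA in auto)
  then have span1: "cyc ?K 3 \<subseteq> fs.span (bnd ?K 3 \<union>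
      wdiff (g o1 t) (g o1 p) ` cyc (rooks g ?A' ?B') 2)"
    by (auto simp: numeral_3_eq_3 numeral_2_eq_2)
  have gen: "wdiff (g s x) (g i x) ` cyc (rooks g (?A' - {i} - {s}) (?B' - {x})) 1 \<subseteq>
      fs.span (bnd (rooks g ?A' ?B') 2 \<union> {wdiff (g s x) (g i x) (wdiff (g l' u) (g l u) unit_chain)})"
    if sl: "A = {o1, i, s, l', l}" "distinct [o1, i, s, l', l]" for s l' l
  proof -
    have "cyc (rooks g (?A' - {i} - {s}) (?B' - {x})) 1 \<subseteq>
        fs.span (bnd (rooks g (?A' - {i} - {s}) (?B' - {x})) 1 \<union> {wdiff (g l' u) (g l u) unit_chain})"
      by (rule two_board_span[OF sub]) (use sl B cB in auto)
    from wdiff_span[OF b' _ _ _ _ _ _ this, of s i x x] sl B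
    show ?thesis by (auto simp: numeral_2_eq_2)
  qed
  let ?G = "{wdiff (g s1 x) (g i x) (wdiff (g s2 u) (g s3 u) unit_chain),
    wdiff (g s2 x) (g i x) (wdiff (g s1 u) (g s3 u) unit_chain),
    wdiff (g s3 x) (g i x) (wdiff (g s1 u) (g s2 u) unit_chain)}"
  have "cyc (rooks g ?A' ?B') 2 \<subseteq> fs.span (bnd (rooks g ?A' ?B') 2 \<union> ?G)"
  proof -
    have "hom_le (rooks g (?A' - {i}) (?B' - {w})) 1 0" if "w \<in> ?B'" for w
      by (rule board_leD[OF board_le_0[of 1 3 2] sub]) (use that A B cA cB in auto)
    from row_span[OF b' _ _ this, of x]
    have 1: "cyc (rooks g ?A' ?B') 2 \<subseteq> fs.span (bnd (rooks g ?A' ?B') 2 \<union>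
      (\<Union>s\<in>?A' - {i}. wdiff (g s x) (g i x) ` cyc (rooks g (?A' - {i} - {s}) (?B' - {x})) 1))"
      using A B by (auto simp: numeral_2_eq_2)
    have "wdiff (g s x) (g i x) ` cyc (rooks g (?A' - {i} - {s}) (?B' - {x})) 1
        \<subseteq> fs.span (bnd (rooks g ?A' ?B') 2 \<union> ?G)" if s: "s \<in> ?A' - {i}" for s
    proof -
      consider "s = s1" | "s = s2" | "s = s3" using s A by auto
      then obtain l' l where l: "A = {o1, i, s, l', l}" "distinct [o1, i, s, l', l]"
        "wdiff (g s x) (g i x) (wdiff (g l' u) (g l u) unit_chain) \<in> ?G"
      proof cases
        case 1 then show ?thesis using A that[of s2 s3] by auto
      next
        case 2 then show ?thesis using A that[of s1 s3] by auto
      next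
        case 3 then show ?thesis using A that[of s1 s2] by auto
      qed
      from gen[OF l(1,2)] show ?thesis
        by (rule order_trans) (use l(3) in \<open>auto intro!: fs.span_mono\<close>)
    qed
    then have "bnd (rooks g ?A' ?B') 2 \<union>
      (\<Union>s\<in>?A' - {i}. wdiff (g s x) (g i x) ` cyc (rooks g (?A' - {i} - {s}) (?B' - {x})) 1)
      \<subseteq> fs.span (bnd (rooks g ?A' ?B') 2 \<union> ?G)"
      using fs.span_superset[of "bnd (rooks g ?A' ?B') 2 \<union> ?G"] by blast
    from fs.span_minimal[OF this fs.subspace_span] 1 show ?thesis by blast
  qed
  from wdiff_span[OF b _ _ _ _ _ _ this, of o1 o1 t p] A B
  have span2: "wdiff (g o1 t) (g o1 p) ` cyc (rooks g ?A' ?B') 2 \<subseteq>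
      fs.span (bnd ?K 3 \<union> {cls s1 s2 s3, cls s2 s1 s3, cls s3 s1 s2})"
    by (auto simp: cls_def numeral_3_eq_3)
  let ?R = "bnd ?K 3 \<union> {cls s3 s1 s2}"
  interpret wd: module_hom cscale cscale "wdiff a c" for a c by (rule linear_wdiff)
  have "cls s2 s1 s3 + cls s3 s1 s2 \<in> bnd ?K 3"
    unfolding cls_def by (rule five_board_antisymmetry[OF b _ _ B]) (use A in auto)
  then have "(cls s2 s1 s3 + cls s3 s1 s2) - cls s3 s1 s2 \<in> fs.span ?R"
    by (intro fs.span_diff fs.span_base) auto
  then have 2: "cls s2 s1 s3 \<in> fs.span ?R" by simp
  \<comment> \<open>Exchanging \<open>s1\<close> and \<open>s3\<close> leads to
    \<open>cls s3 s2 s1\<close>. Exchanging its last two rows is then an exact change of sign, since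
    \<open>wdiff\<close> is antisymmetric in its two edges.\<close>
  have "cls s1 s2 s3 + cls s3 s2 s1 \<in> bnd ?K 3"
    unfolding cls_def by (rule five_board_antisymmetry[OF b _ _ B]) (use A in auto)
  then have "(cls s1 s2 s3 + cls s3 s2 s1) + cls s3 s1 s2 \<in> fs.span ?R"
    by (intro fs.span_add fs.span_base) auto
  moreover have "cls s3 s2 s1 = - cls s3 s1 s2"
  proof -
    have "wdiff (g s2 u) (g s1 u) unit_chain = - wdiff (g s1 u) (g s2 u) unit_chain"
      by (simp add: wdiff_def)
    then show ?thesis by (simp add: cls_def wd.neg)
  qed
  ultimately have 1: "cls s1 s2 s3 \<in> fs.span ?R" by simp
  have "bnd ?K 3 \<union> {cls s1 s2 s3, cls s2 s1 s3, cls s3 s1 s2} \<subseteq> fs.span ?R"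
    using 1 2 by (auto intro: fs.span_base)
  from fs.span_minimal[OF this fs.subspace_span] span2
  have "bnd ?K 3 \<union> wdiff (g o1 t) (g o1 p) ` cyc (rooks g ?A' ?B') 2 \<subseteq> fs.span ?R"
    by (auto intro: fs.span_base)
  from fs.span_minimal[OF this fs.subspace_span] span1
  have "cyc ?K 3 \<subseteq> fs.span ?R" by blast
  then show "hom_le ?K 3 1"
    unfolding hom_le_def by (intro exI[of _ "{cls s3 s1 s2}"]) auto
qed

end

section \<open>Solving the recursion\<close>

definition lead :: "real \<Rightarrow> real \<Rightarrow> real" where
  "lead a b = ((a + 3 * b) ^ 3 - 9 * b ^ 3) / 3"

text \<open>The summands serve three ends. \<open>4 * bound_const k + 12\<close> keeps the base at
  level \<open>k\<close> below the base at level \<open>Suc k\<close> one step earlier; the next two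
  absorb the lower-order terms of the coefficients in the recursion; the last dominates the crude
  count on the square board of side \<open>4 * Suc k + 5\<close>.\<close>

primrec bound_const :: "nat \<Rightarrow> real" where
  "bound_const 0 = 0"
| "bound_const (Suc k) = 4 * bound_const k + 12 + (2 * real (Suc k) + 3)
    + (real (Suc k) ^ 2 + real (Suc k) + 1) + 2 ^ ((4 * Suc k + 5) * (4 * Suc k + 5)) * fact (Suc k)"

text \<open>The weight \<open>1 + a + 2 * b\<close> drops by exactly one from \<open>(a, b)\<close>
  to \<open>(a - 1, b)\<close> and from \<open>(0, b)\<close> to \<open>(1, b - 1)\<close>. Its
  square then yields a linear gain for the lower-order terms.\<close>

definition bound_base :: "nat \<Rightarrow> real \<Rightarrow> real \<Rightarrow> real" where
  "bound_base k a b = lead a b + bound_const k * (1 + a + 2 * b) ^ 2"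

section \<open>Inequalities for the supersolution\<close>

lemma bound_const_nonneg: "0 \<le> bound_const k"
  by (induction k) auto

text \<open>Convexity: the power lies above its tangent at \<open>y\<close>. This bounds from below
  the gain of one recursion step.\<close>

lemma power_Suc_tangent:
  fixes x y :: real
  assumes "0 \<le> y" "y \<le> x"
  shows "y ^ Suc j + real (Suc j) * (x - y) * y ^ j \<le> x ^ Suc j"
proof (induction j)
  case (Suc j)
  have "y ^ Suc (Suc j) + real (Suc (Suc j)) * (x - y) * y ^ Suc j
      \<le> x * (y ^ Suc j + real (Suc j) * (x - y) * y ^ j)"
  proof -
    have "0 \<le> real (Suc j) * (x - y) * y ^ j * (x - y)"
      using assms by (intro mult_nonneg_nonneg) auto
    then show ?thesis by (simp add: algebra_simps)
  qed
  also have "\<dots> \<le> x * x ^ Suc j" using Suc assms by (intro mult_left_mono) auto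
  finally show ?case by simp
qed simp

lemma lead_mult_3: "3 * lead a b = (a + 3 * b) ^ 3 - 9 * b ^ 3"
  by (simp add: lead_def)

lemma lead_nonneg: "0 \<le> a \<Longrightarrow> 0 \<le> b \<Longrightarrow> 0 \<le> lead a b"
proof -
  assume ab: "0 \<le> a" "0 \<le> b"
  then have "(3 * b) ^ 3 \<le> (a + 3 * b) ^ 3" by (intro power_mono) auto
  moreover have "(3 * b) ^ 3 = 27 * b ^ 3" by (simp add: power_mult_distrib)
  moreover have "0 \<le> b ^ 3" using ab by simp
  ultimately have "0 \<le> (a + 3 * b) ^ 3 - 9 * b ^ 3" by linarith
  then show ?thesis by (simp add: lead_def)
qed

text \<open>Allows the lower terms of the recursion at \<open>(a + 1, b - 1)\<close> and
  \<open>(a, b)\<close> to be bounded by one quantity. The fall of \<open>a + 3 * b\<close> by two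
  outweighs the change of \<open>9 * b ^ 3\<close>.\<close>

lemma lead_shift_le:
  assumes "0 \<le> a" "2 \<le> b"
  shows "lead (a + 1) (b - 1) \<le> lead a b"
proof -
  define m where "m = a + 3 * b"
  have "3 * b * (3 * b - 2) \<le> m * (m - 2)"
    using assms by (intro mult_mono) (auto simp: m_def)
  moreover have "0 \<le> b * (b - 2)" using assms by simp
  moreover have "3 * lead a b - 3 * lead (a + 1) (b - 1)
      = 6 * (m * (m - 2)) - (27 * (b * b) - 27 * b + 1)"
    unfolding lead_mult_3 by (simp add: m_def power3_eq_cube algebra_simps)
  moreover have "18 * (b * (3 * b - 2)) - (27 * (b * b) - 27 * b + 1)
      = 27 * (b * (b - 2)) + 45 * b - 1"
    by (simp add: algebra_simps)
  moreover have "3 * b * (3 * b - 2) = 3 * (b * (3 * b - 2))" by simp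
  ultimately show ?thesis
    using assms by linarith
qed

text \<open>\<open>(a - 1, b)\<close> and, on the diagonal, \<open>(1, b - 1)\<close> have nearly the same effect on the leading term:
  both lower it by \<open>(a + 3 b)^2 - (a + 3 b) \<plusminus> 1/3\<close>.\<close>

lemma bound_recursion:
  fixes a b a' b' :: real
  assumes k: "k = Suc j" and ab: "0 \<le> a" "2 \<le> b"
    and pred: "a' = a - 1 \<and> b' = b \<or> a = 0 \<and> a' = 1 \<and> b' = b - 1"
    and N0: "N0 \<le> bound_base k a' b' ^ k / fact k"
    and N1: "0 \<le> N1" "N1 \<le> bound_base j (a + 1) (b - 1) ^ j / fact j"
    and N2: "0 \<le> N2" "N2 \<le> bound_base j a b ^ j / fact j"
  shows "N0 + (real k + a + 3 * b - 2) * (real k + a + 3 * b - 3) * N1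
      + (real k + 2 * a + 3 * b - 1) * N2 \<le> bound_base k a b ^ k / fact k"
proof -
  define m W c where "m = a + 3 * b" and "W = 1 + a + 2 * b" and "c = bound_const k"
  define x y v where "x = bound_base k a b" and "y = bound_base k a' b'" and "v = bound_base j a b"
  have cj: "0 \<le> bound_const j" by (rule bound_const_nonneg)
  have c1: "4 * bound_const j + 12 \<le> c"
    unfolding c_def k by simp
  have c2: "(2 * real k + 3) + (real k ^ 2 + real k + 1) \<le> c"
    unfolding c_def k using cj by simp
  have W': "1 + a' + 2 * b' = W - 1" using pred by (auto simp: W_def)
  have m: "6 \<le> m" "m \<le> 3 / 2 * W" "m \<le> 2 * W - 1" and W: "5 \<le> W"
    using ab by (auto simp: m_def W_def)
  have d: "lead a b - lead a' b' = m\<^sup>2 - m + 1 / 3 \<or> lead a b - lead a' b' = m\<^sup>2 - m - 1 / 3"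
  proof -
    have "3 * lead a b - 3 * lead a' b' = 3 * m\<^sup>2 - 3 * m + 1
        \<or> 3 * lead a b - 3 * lead a' b' = 3 * m\<^sup>2 - 3 * m - 1"
      unfolding lead_mult_3
      using pred by (auto simp: m_def power2_eq_square power3_eq_cube algebra_simps)
    then show ?thesis by auto
  qed
  have v0: "0 \<le> v"
    unfolding v_def bound_base_def using lead_nonneg ab cj by simp
  have z0: "0 \<le> bound_base j (a + 1) (b - 1)"
    unfolding bound_base_def using lead_nonneg ab cj by simp
  have zv: "bound_base j (a + 1) (b - 1) \<le> v"
  proof -
    have "(1 + (a + 1) + 2 * (b - 1)) ^ 2 \<le> (1 + a + 2 * b) ^ 2"
      by (rule power_mono) (use ab in auto)
    then show ?thesis
      unfolding v_def bound_base_def using lead_shift_le[OF ab] cj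
      by (intro add_mono mult_left_mono) auto
  qed
  \<comment> \<open>Passing to the predecessor loses at most \<open>3 * W\<^sup>2\<close> in the
    leading term and replaces \<open>W\<close> by \<open>W - 1 \<ge> W / 2\<close>; the summand
    \<open>4 * bound_const j + 12\<close> of \<open>c\<close> pays for both.\<close>
  have vy: "v \<le> y"
  proof -
    have "lead a b - lead a' b' \<le> m\<^sup>2" using d m by auto
    also have "m\<^sup>2 \<le> (3 / 2 * W)\<^sup>2" using m by (intro power_mono) auto
    also have "\<dots> \<le> 3 * W\<^sup>2" by (simp add: power2_eq_square)
    finally have 1: "lead a b - lead a' b' \<le> 3 * W\<^sup>2" .
    have "W\<^sup>2 \<le> (2 * (W - 1))\<^sup>2" using W by (intro power_mono) auto
    then have "(bound_const j + 3) * W\<^sup>2 \<le> (bound_const j + 3) * (2 * (W - 1))\<^sup>2"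
      using cj by (intro mult_left_mono) auto
    also have "\<dots> = (4 * bound_const j + 12) * (W - 1)\<^sup>2"
      by (simp add: power2_eq_square algebra_simps)
    also have "\<dots> \<le> c * (W - 1)\<^sup>2" using c1 by (intro mult_right_mono) auto
    finally have 2: "bound_const j * W\<^sup>2 + 3 * W\<^sup>2 \<le> c * (W - 1)\<^sup>2" by (simp add: algebra_simps)
    have "v = lead a b + bound_const j * W\<^sup>2" by (simp add: v_def bound_base_def W_def)
    moreover have "y = lead a' b' + c * (W - 1)\<^sup>2" by (simp add: y_def bound_base_def W' c_def)
    ultimately show ?thesis using 1 2 by linarith
  qed
  \<comment> \<open>The total coefficient of the two lower terms once both are bounded by
    \<open>v ^ j / fact j\<close>.\<close>
  define A where "A = (real k + m - 2) * (real k + m - 3) + (real k + 2 * a + 3 * b - 1)"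
  \<comment> \<open>The \<open>m\<^sup>2\<close> in \<open>A\<close> is matched by the drop of the
    leading term. The rest is at most linear in \<open>m\<close> and is covered by the drop
    \<open>c * (2 * W - 1)\<close> of the weighted square.\<close>
  have xy: "A \<le> x - y"
  proof -
    have "(real k + m - 2) * (real k + m - 3) \<le> (real k + m) * (real k + m)"
      using m by (intro mult_mono) auto
    then have A: "A \<le> m\<^sup>2 + (2 * real k + 2) * m + (real k ^ 2 + real k)"
      using ab by (simp add: A_def m_def power2_eq_square algebra_simps)
    have "(2 * real k + 3) * m \<le> (2 * real k + 3) * (2 * W - 1)"
      using m by (intro mult_left_mono) auto
    moreover have "(real k ^ 2 + real k + 1) * 1 \<le> (real k ^ 2 + real k + 1) * (2 * W - 1)"
      using W by (intro mult_left_mono) auto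
    moreover have "((2 * real k + 3) + (real k ^ 2 + real k + 1)) * (2 * W - 1) \<le> c * (2 * W - 1)"
      using c2 W by (intro mult_right_mono) auto
    ultimately have "(2 * real k + 3) * m + (real k ^ 2 + real k + 1) \<le> c * (2 * W - 1)"
      by (simp add: algebra_simps)
    moreover have "x - y = lead a b - lead a' b' + c * (2 * W - 1)"
      unfolding x_def y_def bound_base_def W' c_def[symmetric]
      by (simp add: W_def power2_eq_square algebra_simps)
    moreover have "m\<^sup>2 - m - 1 / 3 \<le> lead a b - lead a' b'" using d by auto
    ultimately show ?thesis using A by (simp add: algebra_simps)
  qed
  have A0: "0 \<le> (real k + m - 2) * (real k + m - 3)" "0 \<le> real k + 2 * a + 3 * b - 1"
    using m ab by auto
  have "bound_base j (a + 1) (b - 1) ^ j / fact j \<le> v ^ j / fact j"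
    by (intro divide_right_mono power_mono zv z0) simp
  with N1(2) have "N1 \<le> v ^ j / fact j" by (rule order_trans)
  moreover have "N2 \<le> v ^ j / fact j" using N2 by (simp add: v_def)
  ultimately have "(real k + m - 2) * (real k + m - 3) * N1 + (real k + 2 * a + 3 * b - 1) * N2
      \<le> (real k + m - 2) * (real k + m - 3) * (v ^ j / fact j)
        + (real k + 2 * a + 3 * b - 1) * (v ^ j / fact j)"
    using A0 by (intro add_mono mult_left_mono) auto
  also have "\<dots> = A * (v ^ j / fact j)" by (simp add: A_def algebra_simps)
  also have "\<dots> \<le> (x - y) * (y ^ j / fact j)"
    using xy A0 v0 vy by (intro mult_mono divide_right_mono power_mono) (auto simp: A_def)
  \<comment> \<open>Extending the fraction by \<open>k\<close> turns \<open>fact j\<close> into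
    \<open>fact k\<close> and produces the tangent term of the \<open>k\<close>-th power.\<close>
  also have "\<dots> = (real k * ((x - y) * y ^ j)) / (real k * fact j)"
    using k by (subst mult_divide_mult_cancel_left) auto
  also have "\<dots> = real k * (x - y) * y ^ j / fact k"
    by (simp only: k fact_Suc mult.assoc)
  finally have "N0 + ((real k + m - 2) * (real k + m - 3) * N1 + (real k + 2 * a + 3 * b - 1) * N2)
      \<le> y ^ k / fact k + real k * (x - y) * y ^ j / fact k"
    using N0 by (intro add_mono) (auto simp: y_def)
  also have "\<dots> = (y ^ Suc j + real (Suc j) * (x - y) * y ^ j) / fact k"
    by (simp add: k add_divide_distrib)
  also have "\<dots> \<le> x ^ Suc j / fact k"
  proof (rule divide_right_mono[OF power_Suc_tangent])
    show "y \<le> x" using xy A0 by (simp add: A_def)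
  qed (use v0 vy in auto)
  finally show ?thesis by (simp add: x_def k m_def algebra_simps)
qed

section \<open>The recursion in the parameters \<open>(k, a, b)\<close>\<close>

context chain_operators
begin

text \<open>Here \<open>(m, n, d) = (k + a + 3b - 1, k + 2a + 3b - 1, k + a + 2b - 2)\<close>, so \<open>(k, a, b)\<close> becomes
  \<open>(k, a - 1, b)\<close>, \<open>(k - 1, a + 1, b - 1)\<close> and \<open>(k - 1, a, b)\<close> in the three terms of the recursion.\<close>

definition param_le :: "nat \<Rightarrow> nat \<Rightarrow> nat \<Rightarrow> nat \<Rightarrow> bool" where
  "param_le k a b N \<longleftrightarrow> board_le (k + a + 3 * b - 1) (k + 2 * a + 3 * b - 1) (k + a + 2 * b - 1) N"

text \<open>For \<open>a = 0\<close> the board with one row and two columns removed has one row more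
  than columns; its transpose is the board of \<open>(k, 1, b - 1)\<close>.\<close>

lemma board_le_param_recursion:
  assumes b: "2 \<le> b"
    and le0: "0 < a \<and> param_le k (a - 1) b N0 \<or> a = 0 \<and> param_le k 1 (b - 1) N0"
    and le1: "board_le (k + a + 3 * b - 4) (k + 2 * a + 3 * b - 3) (k + a + 2 * b - 3) N1"
    and le2: "board_le (k + a + 3 * b - 2) (k + 2 * a + 3 * b - 2) (k + a + 2 * b - 2) N2"
  shows "param_le k a b (N0 + (k + a + 3 * b - 2) * ((k + a + 3 * b - 3) * N1)
    + (k + 2 * a + 3 * b - 1) * N2)"
proof -
  define m n q where "m = k + a + 3 * b - 4" and "n = k + 2 * a + 3 * b - 3"
    and "q = k + a + 2 * b - 3"
  have "board_le (k + a + 3 * b - 2) (k + 2 * a + 3 * b - 3) (k + a + 2 * b - 2) N0"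
  proof (cases "a = 0")
    case True
    then have "board_le (k + 1 + 3 * (b - 1) - 1) (k + 2 * 1 + 3 * (b - 1) - 1)
        (k + 1 + 2 * (b - 1) - 1) N0"
      using le0 by (simp add: param_le_def)
    moreover have "k + 1 + 3 * (b - 1) - 1 = k + 2 * a + 3 * b - 3"
      "k + 2 * 1 + 3 * (b - 1) - 1 = k + a + 3 * b - 2"
      "k + 1 + 2 * (b - 1) - 1 = k + a + 2 * b - 2"
      using True b by auto
    ultimately show ?thesis using board_le_transpose by metis
  next
    case False
    then have "board_le (k + (a - 1) + 3 * b - 1) (k + 2 * (a - 1) + 3 * b - 1)
        (k + (a - 1) + 2 * b - 1) N0"
      using le0 by (simp add: param_le_def)
    moreover have "k + (a - 1) + 3 * b - 1 = k + a + 3 * b - 2"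
      "k + 2 * (a - 1) + 3 * b - 1 = k + 2 * a + 3 * b - 3"
      "k + (a - 1) + 2 * b - 1 = k + a + 2 * b - 2"
      using False b by auto
    ultimately show ?thesis by simp
  qed
  moreover have eqs: "k + a + 3 * b - 2 = m + 2" "k + a + 2 * b - 2 = Suc q"
    "k + 2 * a + 3 * b - 2 = n + 1" "k + a + 3 * b - 1 = m + 3" "k + 2 * a + 3 * b - 1 = n + 2"
    "k + a + 2 * b - 1 = Suc (Suc q)" "k + a + 3 * b - 3 = m + 1"
    using b by (auto simp: m_def n_def q_def)
  ultimately have "board_le (m + 2) n (Suc q) N0" by (simp add: n_def)
  moreover have "board_le m n q N1" using le1 by (simp add: m_def n_def q_def)
  moreover have "board_le (m + 2) (n + 1) (Suc q) N2" using le2 unfolding eqs .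
  ultimately show ?thesis
    unfolding param_le_def eqs by (rule board_le_recursion)
qed

lemma param_le_0: "2 \<le> b \<Longrightarrow> param_le 0 a b 1"
proof (induction "a + 2 * b" arbitrary: a b rule: less_induct)
  case less
  show ?case
  proof (cases "a = 0 \<and> b = 2")
    case True
    then show ?thesis using board_le_5_5 by (simp add: param_le_def)
  next
    case False
    have "0 < a \<and> param_le 0 (a - 1) b 1 \<or> a = 0 \<and> param_le 0 1 (b - 1) 1"
      using less.hyps[of "a - 1" b] less.hyps[of 1 "b - 1"] less.prems False by (cases "a = 0") auto
    \<comment> \<open>This board and the next satisfy \<open>3 * q + 2 = m + n\<close>, the edge of
      the vanishing range, so the bound 1 is carried unchanged from \<open>(0, 2)\<close>.\<close>
    moreover have "board_le (0 + a + 3 * b - 4) (0 + 2 * a + 3 * b - 3) (0 + a + 2 * b - 3) 0"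
      by (rule board_le_0) (use less.prems in auto)
    moreover have "board_le (0 + a + 3 * b - 2) (0 + 2 * a + 3 * b - 2) (0 + a + 2 * b - 2) 0"
      by (rule board_le_0) (use less.prems in auto)
    ultimately have "param_le 0 a b (1 + (0 + a + 3 * b - 2) * ((0 + a + 3 * b - 3) * 0)
        + (0 + 2 * a + 3 * b - 1) * 0)"
      by (rule board_le_param_recursion[OF less.prems])
    then show ?thesis by simp
  qed
qed

text \<open>The crude count times \<open>fact k\<close> is a summand of
  \<open>bound_const k\<close>, and a base of at least 1 does not exceed its \<open>k\<close>-th
  power for \<open>k > 0\<close>.\<close>

lemma param_le_base:
  assumes "0 < k"
  shows "\<exists>N. param_le k 0 (k + 2) N \<and> real N \<le> bound_base k 0 (real (k + 2)) ^ k / fact k"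
proof -
  obtain j where k: "k = Suc j" using assms gr0_implies_Suc by blast
  let ?N = "2 ^ ((4 * k + 5) * (4 * k + 5)) :: nat"
  have "k + 0 + 3 * (k + 2) - 1 = 4 * k + 5" "k + 2 * 0 + 3 * (k + 2) - 1 = 4 * k + 5" by auto
  then have "param_le k 0 (k + 2) ?N"
    unfolding param_le_def by (simp only: board_le_finite)
  moreover have "real ?N * fact k \<le> bound_base k 0 (real (k + 2)) ^ k"
  proof -
    have "real ?N * fact k \<le> bound_const k"
      using bound_const_nonneg[of j] by (simp add: k del: fact_Suc)
    also have "\<dots> \<le> bound_const k * (1 + 0 + 2 * real (k + 2)) ^ 2"
    proof -
      have "1 \<le> (1 + 0 + 2 * real (k + 2)) ^ 2" by (rule one_le_power) simp
      from mult_left_mono[OF this bound_const_nonneg[of k]] show ?thesis by (simp only: mult_1_right)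
    qed
    also have "\<dots> \<le> bound_base k 0 (real (k + 2))"
      using lead_nonneg[of 0 "real (k + 2)"] by (simp add: bound_base_def)
    finally have 1: "real ?N * fact k \<le> bound_base k 0 (real (k + 2))" .
    have "1 * 1 \<le> real ?N * fact k" by (intro mult_mono fact_ge_1) auto
    with 1 have "1 \<le> bound_base k 0 (real (k + 2))" by linarith
    then have "bound_base k 0 (real (k + 2)) \<le> bound_base k 0 (real (k + 2)) ^ k"
      using assms by (rule self_le_power)
    with 1 show ?thesis by linarith
  qed
  then have "real ?N \<le> bound_base k 0 (real (k + 2)) ^ k / fact k"
    by (simp add: field_simps)
  ultimately show ?thesis by blast
qed

text \<open>Induction on \<open>k\<close> and, for fixed \<open>k\<close>, on
  \<open>a + 2 * b\<close>, which drops by one along the first term down to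
  \<open>(0, k + 2)\<close>. The terms of level \<open>k - 1\<close> stay in the region since
  \<open>b \<ge> k + 2\<close> gives \<open>b - 1 \<ge> (k - 1) + 2\<close>.\<close>

lemma param_le_bound:
  "k + 2 \<le> b \<Longrightarrow> \<exists>N. param_le k a b N \<and> real N \<le> bound_base k (real a) (real b) ^ k / fact k"
proof (induction k arbitrary: a b)
  case 0
  then show ?case using param_le_0 by (intro exI[of _ 1]) auto
next
  case (Suc j)
  define k where "k = Suc j"
  from Suc.prems show ?case
    unfolding k_def[symmetric]
  proof (induction "a + 2 * b" arbitrary: a b rule: less_induct)
    case less
    show ?case
    proof (cases "a = 0 \<and> b = k + 2")
      case True
      then show ?thesis using param_le_base[of k] by (simp add: k_def)
    next
      case False
      have b2: "2 \<le> b" using less.prems by simp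
      obtain a' b' where pred: "0 < a \<and> a' = a - 1 \<and> b' = b \<or> a = 0 \<and> a' = 1 \<and> b' = b - 1"
        by (cases "a = 0") auto
      then have "a' + 2 * b' < a + 2 * b" "k + 2 \<le> b'" using False less.prems by auto
      from less.hyps[OF this] obtain N0 where N0: "param_le k a' b' N0"
        "real N0 \<le> bound_base k (real a') (real b') ^ k / fact k" by blast
      obtain N1 where N1: "param_le j (a + 1) (b - 1) N1"
        "real N1 \<le> bound_base j (real (a + 1)) (real (b - 1)) ^ j / fact j"
      proof -
        have "j + 2 \<le> b - 1" using less.prems by (simp add: k_def)
        from Suc.IH[OF this, of "a + 1"] show ?thesis using that by blast
      qed
      obtain N2 where N2: "param_le j a b N2" "real N2 \<le> bound_base j (real a) (real b) ^ j / fact j"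
        using Suc.IH[of b a] less.prems by (auto simp: k_def)
      have "j + (a + 1) + 3 * (b - 1) - 1 = k + a + 3 * b - 4"
        "j + 2 * (a + 1) + 3 * (b - 1) - 1 = k + 2 * a + 3 * b - 3"
        "j + (a + 1) + 2 * (b - 1) - 1 = k + a + 2 * b - 3"
        using b2 by (auto simp: k_def)
      then have le1: "board_le (k + a + 3 * b - 4) (k + 2 * a + 3 * b - 3) (k + a + 2 * b - 3) N1"
        using N1(1) by (simp add: param_le_def)
      have le2: "board_le (k + a + 3 * b - 2) (k + 2 * a + 3 * b - 2) (k + a + 2 * b - 2) N2"
        using N2(1) b2 by (simp add: param_le_def k_def)
      let ?N = "N0 + (k + a + 3 * b - 2) * ((k + a + 3 * b - 3) * N1) + (k + 2 * a + 3 * b - 1) * N2"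
      have "param_le k a b ?N"
        by (rule board_le_param_recursion[OF b2 _ le1 le2]) (use pred N0(1) in auto)
      moreover have "real ?N \<le> bound_base k (real a) (real b) ^ k / fact k"
      proof -
        have "real N0 + (real k + real a + 3 * real b - 2) * (real k + real a + 3 * real b - 3) * real N1
            + (real k + 2 * real a + 3 * real b - 1) * real N2
            \<le> bound_base k (real a) (real b) ^ k / fact k"
        proof (rule bound_recursion[OF k_def _ _ _ N0(2) _ _ _ N2(2)])
          show "real a' = real a - 1 \<and> real b' = real b
              \<or> real a = 0 \<and> real a' = 1 \<and> real b' = real b - 1"
            using pred b2 by auto
          show "real N1 \<le> bound_base j (real a + 1) (real b - 1) ^ j / fact j"
            using N1(2) b2 by (simp add: add.commute)
        qed (use b2 in auto)
        moreover have "real (k + a + 3 * b - 2) = real k + real a + 3 * real b - 2"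
          "real (k + a + 3 * b - 3) = real k + real a + 3 * real b - 3"
          "real (k + 2 * a + 3 * b - 1) = real k + 2 * real a + 3 * real b - 1"
          using b2 by auto
        ultimately show ?thesis by (simp only: of_nat_add of_nat_mult mult.assoc)
      qed
      ultimately show ?thesis by blast
    qed
  qed
qed

end

section \<open>The bounding polynomials\<close>

text \<open>An upper bound for the total degree that composes under ring operations. It also makes
  the set of exponents finite, so that \<open>Max\<close> in \<open>total_degree\<close> is
  meaningful.\<close>

definition deg_le :: "real poly poly \<Rightarrow> nat \<Rightarrow> bool" where
  "deg_le p D \<longleftrightarrow> (\<forall>i j. coeff (coeff p j) i \<noteq> 0 \<longrightarrow> i + j \<le> D)"

section \<open>Rules for total degrees\<close>

lemma deg_le_mono: "deg_le p D \<Longrightarrow> D \<le> D' \<Longrightarrow> deg_le p D'"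
  unfolding deg_le_def by (meson order_trans)

lemma deg_le_add: "deg_le p D \<Longrightarrow> deg_le q D \<Longrightarrow> deg_le (p + q) D"
  unfolding deg_le_def by (metis add.right_neutral coeff_add)

lemma deg_le_diff: "deg_le p D \<Longrightarrow> deg_le q D \<Longrightarrow> deg_le (p - q) D"
  unfolding deg_le_def by (metis diff_self coeff_diff)

lemma deg_le_mult:
  assumes p: "deg_le p D" and q: "deg_le q D'"
  shows "deg_le (p * q) (D + D')"
  unfolding deg_le_def
proof (intro allI impI)
  fix i j assume "coeff (coeff (p * q) j) i \<noteq> 0"
  then have "(\<Sum>j'\<le>j. \<Sum>i'\<le>i. coeff (coeff p j') i' * coeff (coeff q (j - j')) (i - i')) \<noteq> 0"
    by (simp add: coeff_mult coeff_sum)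
  then obtain j' where j': "j' \<le> j"
    "(\<Sum>i'\<le>i. coeff (coeff p j') i' * coeff (coeff q (j - j')) (i - i')) \<noteq> 0"
    by (meson atMost_iff sum.not_neutral_contains_not_neutral)
  then obtain i' where i': "i' \<le> i" "coeff (coeff p j') i' * coeff (coeff q (j - j')) (i - i') \<noteq> 0"
    by (meson atMost_iff sum.not_neutral_contains_not_neutral)
  then have "coeff (coeff p j') i' \<noteq> 0" "coeff (coeff q (j - j')) (i - i') \<noteq> 0" by auto
  then have "i' + j' \<le> D" "(i - i') + (j - j') \<le> D'"
    using p q unfolding deg_le_def by blast+
  then show "i + j \<le> D + D'" using i'(1) j'(1) by linarith
qed

lemma deg_le_power: "deg_le p D \<Longrightarrow> deg_le (p ^ k) (k * D)"
proof (induction k)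
  case 0
  show ?case by (auto simp: deg_le_def coeff_1 split: if_splits)
next
  case (Suc k)
  then show ?case using deg_le_mult[of p D "p ^ k" "k * D"] by simp
qed

lemma total_degree_le:
  assumes "\<And>i j. coeff (coeff p j) i \<noteq> 0 \<Longrightarrow> int (i + j) \<le> D" "-1 \<le> D"
  shows "total_degree p \<le> D"
proof -
  let ?S = "{int (i + j) | i j. coeff (coeff p j) i \<noteq> 0}"
  have "?S \<subseteq> {0..D}" using assms(1) by force
  then have "finite ?S" by (rule finite_subset) simp
  then show ?thesis
    unfolding total_degree_def using assms by (subst Max_le_iff) auto
qed

lemma le_total_degree:
  assumes "deg_le p D" "coeff (coeff p j) i \<noteq> 0"
  shows "int (i + j) \<le> total_degree p"
proof -
  let ?S = "{int (i + j) | i j. coeff (coeff p j) i \<noteq> 0}"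
  have "?S \<subseteq> {0..int D}" using assms(1) unfolding deg_le_def by force
  then have "finite ?S" by (rule finite_subset) simp
  then show ?thesis
    unfolding total_degree_def using assms by (intro Max_ge) auto
qed

section \<open>The polynomials \<open>f_k\<close> and their leading parts\<close>

definition const2 :: "real \<Rightarrow> real poly poly" where "const2 c = [:[:c:]:]"
definition varA :: "real poly poly" where "varA = [:[:0, 1:]:]"
definition varB :: "real poly poly" where "varB = [:0, 1:]"

lemma poly2_simps:
  "poly2 (p + q) a b = poly2 p a b + poly2 q a b"
  "poly2 (p - q) a b = poly2 p a b - poly2 q a b"
  "poly2 (p * q) a b = poly2 p a b * poly2 q a b"
  "poly2 (p ^ n) a b = poly2 p a b ^ n"
  "poly2 (const2 c) a b = c" "poly2 varA a b = a" "poly2 varB a b = b"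
  by (simp_all add: poly2_def const2_def varA_def varB_def)

lemma deg_le_basic: "deg_le (const2 c) 0" "deg_le varA 1" "deg_le varB 1"
  by (auto simp: deg_le_def const2_def varA_def varB_def coeff_pCons split: nat.splits)

definition lead_poly :: "real poly poly" where
  "lead_poly = const2 (1 / 3) * ((varA + const2 3 * varB) ^ 3 - const2 9 * varB ^ 3)"

definition weight_poly :: "real \<Rightarrow> real poly poly" where
  "weight_poly c = const2 c * (const2 1 + varA + const2 2 * varB) ^ 2"

definition bound_poly :: "nat \<Rightarrow> real poly poly" where
  "bound_poly k = const2 (1 / fact k) * (lead_poly + weight_poly (bound_const k)) ^ k"

lemma poly2_bound_poly: "poly2 (bound_poly k) a b = bound_base k a b ^ k / fact k"
  by (simp add: bound_poly_def poly2_simps lead_poly_def weight_poly_def bound_base_def lead_def)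

lemma deg_le_linear: "deg_le (const2 c * varB) 1" "deg_le (varA + const2 c * varB) 1"
  "deg_le (const2 1 + varA + const2 c * varB) 1"
proof -
  show 1: "deg_le (const2 c * varB) 1"
    using deg_le_mult[OF deg_le_basic(1) deg_le_basic(3)] by simp
  then show "deg_le (varA + const2 c * varB) 1" by (intro deg_le_add deg_le_basic)
  show "deg_le (const2 1 + varA + const2 c * varB) 1"
    by (intro deg_le_add deg_le_basic 1 deg_le_mono[OF deg_le_basic(1)]) simp
qed

lemma deg_le_lead_poly: "deg_le lead_poly 3"
proof -
  have "deg_le ((varA + const2 3 * varB) ^ 3) 3" using deg_le_power[OF deg_le_linear(2), of 3] by simp
  moreover have "deg_le (const2 9 * varB ^ 3) 3"
    using deg_le_mult[OF deg_le_basic(1) deg_le_power[OF deg_le_basic(3), of 3]] by simp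
  ultimately have "deg_le ((varA + const2 3 * varB) ^ 3 - const2 9 * varB ^ 3) 3"
    by (rule deg_le_diff)
  from deg_le_mult[OF deg_le_basic(1) this] show ?thesis by (simp add: lead_poly_def)
qed

lemma deg_le_weight_poly: "deg_le (weight_poly c) 2"
  using deg_le_mult[OF deg_le_basic(1) deg_le_power[OF deg_le_linear(3), of 2]]
  by (simp add: weight_poly_def)

text \<open>Each further factor \<open>p + q\<close> raises the bound by three, and the new term
  \<open>q * p ^ Suc j\<close> stays one below the bound of the full power.\<close>

lemma deg_le_power_add_diff:
  assumes p: "deg_le p 3" and q: "deg_le q 2"
  shows "deg_le ((p + q) ^ Suc j - p ^ Suc j) (3 * j + 2)"
proof (induction j)
  case 0
  then show ?case using q by (simp add: numeral_2_eq_2)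
next
  case (Suc j)
  have "deg_le (p + q) 3" by (intro deg_le_add p deg_le_mono[OF q]) simp
  from deg_le_mult[OF this Suc.IH]
  have "deg_le ((p + q) * ((p + q) ^ Suc j - p ^ Suc j)) (3 * Suc j + 2)"
    by (rule deg_le_mono) simp
  moreover have "deg_le (q * p ^ Suc j) (3 * Suc j + 2)"
    by (rule deg_le_mono[OF deg_le_mult[OF q deg_le_power[OF p]]]) simp
  ultimately have "deg_le ((p + q) * ((p + q) ^ Suc j - p ^ Suc j) + q * p ^ Suc j) (3 * Suc j + 2)"
    by (rule deg_le_add)
  then show ?case by (simp add: algebra_simps)
qed

lemma bound_poly_remainder:
  "total_degree (bound_poly k - const2 (1 / fact k) * lead_poly ^ k) \<le> 3 * int k - 1"
proof (cases k)
  case 0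
  \<comment> \<open>Both polynomials are 1, so the remainder is zero, of degree
    \<open>-1 = 3 * 0 - 1\<close>.\<close>
  then show ?thesis by (intro total_degree_le) (auto simp: bound_poly_def)
next
  case (Suc j)
  have "deg_le (const2 (1 / fact k) * ((lead_poly + weight_poly (bound_const k)) ^ Suc j - lead_poly ^ Suc j))
      (0 + (3 * j + 2))"
    by (intro deg_le_mult deg_le_basic deg_le_power_add_diff deg_le_lead_poly deg_le_weight_poly)
  then have "deg_le (bound_poly k - const2 (1 / fact k) * lead_poly ^ k) (3 * j + 2)"
    by (simp add: bound_poly_def Suc right_diff_distrib del: power_Suc fact_Suc)
  then show ?thesis
    unfolding deg_le_def by (intro total_degree_le) (force simp: Suc)+
qed

text \<open>The monomial \<open>a ^ (3 * k)\<close> survives: the degree of the remainder is too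
  small to reach it, and at \<open>b = 0\<close> the leading part is
  \<open>(a ^ 3 / 3) ^ k / fact k\<close>.\<close>

lemma total_degree_bound_poly: "total_degree (bound_poly k) = 3 * int k"
proof (rule antisym)
  have deg: "deg_le (bound_poly k) (3 * k)"
  proof -
    have "deg_le (lead_poly + weight_poly (bound_const k)) 3"
      by (intro deg_le_add deg_le_lead_poly deg_le_mono[OF deg_le_weight_poly]) simp
    from deg_le_mult[OF deg_le_basic(1) deg_le_power[OF this]]
    show ?thesis by (simp add: bound_poly_def mult.commute)
  qed
  then show "total_degree (bound_poly k) \<le> 3 * int k"
    unfolding deg_le_def by (intro total_degree_le) force+
  have "coeff (coeff (bound_poly k - const2 (1 / fact k) * lead_poly ^ k) 0) (3 * k) = 0"
  proof (rule ccontr)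
    assume nz: "coeff (coeff (bound_poly k - const2 (1 / fact k) * lead_poly ^ k) 0) (3 * k) \<noteq> 0"
    have "deg_le (const2 (1 / fact k) * lead_poly ^ k) (0 + k * 3)"
      by (intro deg_le_mult deg_le_basic deg_le_power deg_le_lead_poly)
    then have "deg_le (bound_poly k - const2 (1 / fact k) * lead_poly ^ k) (3 * k)"
      using deg by (intro deg_le_diff) (simp_all add: mult.commute)
    from le_total_degree[OF this nz] bound_poly_remainder[of k] show False by simp
  qed
  moreover have "coeff (coeff (const2 (1 / fact k) * lead_poly ^ k) 0) (3 * k) = (1 / 3) ^ k / fact k"
  proof -
    have "poly lead_poly 0 = monom (1 / 3) 3"
      by (simp add: lead_poly_def const2_def varA_def varB_def monom_altdef)
    then have "coeff (const2 (1 / fact k) * lead_poly ^ k) 0 = Polynomial.smult (1 / fact k) (monom ((1 / 3) ^ k) (3 * k))"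
      by (simp add: const2_def monom_power flip: poly_0_coeff_0)
    then show ?thesis by simp
  qed
  ultimately have "coeff (coeff (bound_poly k) 0) (3 * k) \<noteq> 0" by simp
  from le_total_degree[OF deg this] show "3 * int k \<le> total_degree (bound_poly k)" by simp
qed

section \<open>Homology as a quotient space\<close>

definition coset :: "('s \<Rightarrow> 'f::field) set \<Rightarrow> ('s \<Rightarrow> 'f) \<Rightarrow> ('s \<Rightarrow> 'f) set" where
  "coset N z = (\<lambda>h. h + z) ` N"

lemma coset_eq:
  assumes "fs.subspace N" "x - y \<in> N"
  shows "coset N x = coset N y"
proof -
  have sub: "coset N x \<subseteq> coset N y" if "x - y \<in> N" for x y
  proof
    fix v assume "v \<in> coset N x"
    then obtain h where h: "h \<in> N" "v = h + x" by (auto simp: coset_def)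
    then have "v = (h + (x - y)) + y" by simp
    moreover have "h + (x - y) \<in> N" using assms h that by (intro fs.subspace_add)
    ultimately show "v \<in> coset N y" unfolding coset_def by blast
  qed
  have "y - x \<in> N" using fs.subspace_neg[OF assms] by simp
  then show ?thesis using sub assms(2) by blast
qed

lemma coset_member: "fs.subspace N \<Longrightarrow> v \<in> coset N x \<longleftrightarrow> v - x \<in> N"
  unfolding coset_def by (force simp: image_iff intro: bexI[of _ "v - x"])

lemma coset_0: "coset N 0 = N"
  by (simp add: coset_def)

text \<open>\<open>Z\<close> and \<open>N\<close> stand for cycles and boundaries, \<open>M\<close>
  for the record of cycles inside \<open>reduced_homology\<close>.\<close>

locale chain_quotient =
  fixes N Z :: "('v set \<Rightarrow> 'f::field) set" and M :: "('f, 'v set \<Rightarrow> 'f) module"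
  assumes N: "fs.subspace N" and Z: "fs.subspace Z" and NZ: "N \<subseteq> Z"
    and M: "carrier M = Z" "add M = (+)" "smult M = cscale"
begin

section \<open>The quotient module and its dimension\<close>

lemma r_coset: "N +>\<^bsub>M\<^esub> z = coset N z"
  by (auto simp: a_r_coset_def' M coset_def)

lemma set_add: "coset N x <+>\<^bsub>M\<^esub> coset N y = coset N (x + y)"
proof -
  have "h + x + (h' + y) - (x + y) \<in> N" if "h \<in> N" "h' \<in> N" for h h'
    using fs.subspace_add[OF N that] by (simp add: algebra_simps)
  moreover have "\<exists>h\<in>N. \<exists>h'\<in>N. v = h + x + (h' + y)" if "v - (x + y) \<in> N" for v
    using that fs.subspace_0[OF N] by (intro bexI[of _ "v - (x + y)"] bexI[of _ 0]) auto
  ultimately show ?thesis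
    by (auto simp: set_add_def' M coset_member[OF N] coset_def[of N x] coset_def[of N y])
qed

lemma smult_coset: "(\<Union>x'\<in>coset N x. N +>\<^bsub>M\<^esub> (a \<odot>\<^bsub>M\<^esub> x')) = coset N (cscale a x)"
proof -
  have "coset N (cscale a x') = coset N (cscale a x)" if "x' \<in> coset N x" for x'
  proof (rule coset_eq[OF N])
    have "cscale a (x' - x) \<in> N" using that N by (intro fs.subspace_scale) (auto simp: coset_member)
    then show "cscale a x' - cscale a x \<in> N" by (simp add: fs.scale_right_diff_distrib)
  qed
  moreover have "x \<in> coset N x" using N by (simp add: coset_member fs.subspace_0)
  ultimately show ?thesis unfolding r_coset M by blast
qed

abbreviation "Q \<equiv> quotient_module M N"

lemma Q_simps:
  "carrier Q = coset N ` Z" "zero Q = coset N 0"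
  "coset N x \<oplus>\<^bsub>Q\<^esub> coset N y = coset N (x + y)" "a \<odot>\<^bsub>Q\<^esub> coset N x = coset N (cscale a x)"
proof -
  show "carrier Q = coset N ` Z" by (auto simp: quotient_module_def A_RCOSETS_def' r_coset M)
  show "zero Q = coset N 0" by (simp add: quotient_module_def coset_0)
  show "coset N x \<oplus>\<^bsub>Q\<^esub> coset N y = coset N (x + y)" by (simp add: quotient_module_def set_add)
  have "a \<odot>\<^bsub>Q\<^esub> coset N x = (\<Union>x'\<in>coset N x. N +>\<^bsub>M\<^esub> (a \<odot>\<^bsub>M\<^esub> x'))"
    by (simp add: quotient_module_def)
  then show "a \<odot>\<^bsub>Q\<^esub> coset N x = coset N (cscale a x)" by (simp only: smult_coset)
qed

lemma module_Q: "Module.module (class_ring :: 'f ring) Q"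
proof (rule Module.moduleI)
  show "cring (class_ring :: 'f ring)" by unfold_locales
  show "abelian_group Q"
  proof (rule abelian_groupI)
    show "\<exists>y\<in>carrier Q. y \<oplus>\<^bsub>Q\<^esub> x = \<zero>\<^bsub>Q\<^esub>" if x: "x \<in> carrier Q" for x
    proof -
      obtain z where z: "z \<in> Z" "x = coset N z" using x by (auto simp: Q_simps)
      then have "coset N (- z) \<oplus>\<^bsub>Q\<^esub> x = \<zero>\<^bsub>Q\<^esub>" by (simp add: Q_simps)
      moreover have "coset N (- z) \<in> carrier Q"
        using z fs.subspace_neg[OF Z] by (auto simp: Q_simps)
      ultimately show ?thesis by blast
    qed
  qed (auto simp: Q_simps add_ac intro!: imageI fs.subspace_add[OF Z] fs.subspace_0[OF Z])
qed (auto simp: Q_simps fs.scale_left_distrib fs.scale_right_distrib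
    intro!: imageI fs.subspace_scale[OF Z])

lemma vectorspace_Q: "vectorspace (class_ring :: 'f ring) Q"
  unfolding vectorspace_def using module_Q class_field by blast

lemma dim_Q_le:
  assumes S: "finite S" "Z \<subseteq> fs.span (N \<union> S)"
  shows "vectorspace.dim (class_ring :: 'f ring) Q \<le> card S"
proof -
  interpret V: vectorspace "class_ring :: 'f ring" Q by (rule vectorspace_Q)
  \<comment> \<open>\<open>S\<close> need not lie in \<open>Z\<close>. Taking the identity as the
    linear map exchanges it for a set \<open>T\<close> inside \<open>Z\<close> that is no
    larger.\<close>
  have id: "fun_linear (\<lambda>c. c)" by (rule fun_linearI) auto
  obtain T where T: "T \<subseteq> Z" "finite T" "card T \<le> card S"
    "Z \<subseteq> fs.span (T \<union> {v \<in> Z. v \<in> fs.span N})"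
    using subspace_preimage_generators[OF id Z S(1), of N] S(2) by auto
  have spN: "fs.span N = N" using N by simp
  let ?T = "coset N ` T"
  have TQ: "?T \<subseteq> carrier Q" using T by (auto simp: Q_simps)
  interpret sp: LinearCombinations.submodule "class_ring :: 'f ring" "V.span ?T" Q
    using V.span_is_submodule[OF TQ] .
  have "fs.span (T \<union> {v \<in> Z. v \<in> fs.span N}) \<subseteq> {z. coset N z \<in> V.span ?T}"
  proof (rule fs.span_minimal)
    show "fs.subspace {z. coset N z \<in> V.span ?T}"
      unfolding fs.subspace_def
      using sp.zero_closed sp.m_closed sp.smult_closed by (auto simp flip: Q_simps)
    have "coset N v = \<zero>\<^bsub>Q\<^esub>" if "v \<in> N" for v
      using coset_eq[OF N, of v 0] that by (simp add: Q_simps)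
    then show "T \<union> {v \<in> Z. v \<in> fs.span N} \<subseteq> {z. coset N z \<in> V.span ?T}"
      unfolding spN using V.in_own_span[OF TQ] sp.zero_closed by auto
  qed
  then have "carrier Q \<subseteq> V.span ?T" using T(4) by (auto simp: Q_simps)
  then have "V.span ?T = carrier Q" using sp.subset by blast
  then have "V.dim \<le> card ?T" using T(2) TQ by (intro V.gen_ge_dim) auto
  also have "\<dots> \<le> card T" using T(2) by (rule card_image_le)
  finally show ?thesis using T(3) by simp
qed

end

section \<open>Passage to the homology of the chessboard complex\<close>

abbreviation lex_order :: "((nat \<times> nat) \<times> (nat \<times> nat)) set" where
  "lex_order \<equiv> less_than <*lex*> less_than"

lemma chain_operators_lex: "finite E \<Longrightarrow> chain_operators lex_order E"
  by unfold_locales auto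

text \<open>Identifies \<open>boundary_map\<close> with the sum of contractions, for the labelling
  \<open>Pair\<close>. Faces with \<open>q\<close> vertices have dimension
  \<open>q - 1\<close>.\<close>

lemma chessboard_betti_le:
  assumes "chain_operators.board_le TYPE('f::field) lex_order ({..<m} \<times> {..<n}) m n q N"
  shows "chessboard_betti TYPE('f) m n (int q - 1) \<le> N"
proof -
  let ?E = "{..<m} \<times> {..<n}" and ?K = "chessboard_complex m n"
  interpret C: chain_operators "TYPE('f)" lex_order ?E by (rule chain_operators_lex) simp
  have K: "C.rooks Pair {..<m} {..<n} = ?K"
    unfolding C.rooks_def chessboard_complex_def by fastforce
  have b: "C.board Pair {..<m} {..<n}" by (auto simp: C.board_def)
  have KE: "\<sigma> \<subseteq> ?E" if "\<sigma> \<in> ?K" for \<sigma>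
    using that by (auto simp: chessboard_complex_def)
  then have finK: "finite ?K" by (intro finite_subset[of ?K "Pow ?E"]) auto
  have car: "carrier (chain_space ?K (int q' - 1)) = C.chains ?K q'" for q'
    by (simp add: chain_space_def C.chains_def)
  have bd: "boundary_map lex_order ?K c = C.bdry c" if "c \<in> C.chains ?K q'" for c q'
  proof
    fix \<tau>
    have "boundary_map lex_order ?K c \<tau>
        = (\<Sum>\<sigma>\<in>?K. \<Sum>v\<in>?E. if v \<in> \<sigma> \<and> \<sigma> - {v} = \<tau> then (-1) ^ card {u \<in> \<sigma>. (u, v) \<in> lex_order} * c \<sigma> else 0)"
      unfolding boundary_map_def
    proof (rule sum.cong)
      fix \<sigma> assume "\<sigma> \<in> ?K"
      then have "{v. v \<in> \<sigma> \<and> \<sigma> - {v} = \<tau>} = {v \<in> ?E. v \<in> \<sigma> \<and> \<sigma> - {v} = \<tau>}"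
        using KE by blast
      then show "(\<Sum>v | v \<in> \<sigma> \<and> \<sigma> - {v} = \<tau>. (-1) ^ card {u \<in> \<sigma>. (u, v) \<in> lex_order} * c \<sigma>)
        = (\<Sum>v\<in>?E. if v \<in> \<sigma> \<and> \<sigma> - {v} = \<tau> then (-1) ^ card {u \<in> \<sigma>. (u, v) \<in> lex_order} * c \<sigma> else 0)"
        by (simp add: sum.inter_filter)
    qed simp
    \<comment> \<open>With \<open>v\<close> fixed only \<open>\<sigma> = insert v \<tau>\<close> can
      contribute, and only if \<open>v \<notin> \<tau>\<close>.\<close>
    also have "\<dots> = (\<Sum>v\<in>?E. \<Sum>\<sigma>\<in>?K. if v \<in> \<sigma> \<and> \<sigma> - {v} = \<tau> then (-1) ^ card {u \<in> \<sigma>. (u, v) \<in> lex_order} * c \<sigma> else 0)"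
      by (rule sum.swap)
    also have "\<dots> = (\<Sum>v\<in>?E. C.contr v c \<tau>)"
    proof (rule sum.cong)
      fix v assume "v \<in> ?E"
      show "(\<Sum>\<sigma>\<in>?K. if v \<in> \<sigma> \<and> \<sigma> - {v} = \<tau> then (-1) ^ card {u \<in> \<sigma>. (u, v) \<in> lex_order} * c \<sigma> else 0)
        = C.contr v c \<tau>"
      proof (cases "v \<notin> \<tau> \<and> insert v \<tau> \<in> ?K")
        case True
        have "(\<Sum>\<sigma>\<in>?K. if v \<in> \<sigma> \<and> \<sigma> - {v} = \<tau> then (-1) ^ card {u \<in> \<sigma>. (u, v) \<in> lex_order} * c \<sigma> else 0)
            = (\<Sum>\<sigma>\<in>?K. if \<sigma> = insert v \<tau> then (-1) ^ card {u \<in> \<sigma>. (u, v) \<in> lex_order} * c \<sigma> else 0)"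
          by (rule sum.cong) (use True in auto)
        also have "\<dots> = (-1) ^ card {u \<in> insert v \<tau>. (u, v) \<in> lex_order} * c (insert v \<tau>)"
          using finK True by simp
        \<comment> \<open>Faces lie in \<open>?E\<close>, so the intersection in
          \<open>vsign\<close> does not alter the sign.\<close>
        also have "{u \<in> insert v \<tau>. (u, v) \<in> lex_order} = {u \<in> insert v \<tau> \<inter> ?E. (u, v) \<in> lex_order}"
          using KE True by blast
        also have "(-1) ^ card \<dots> * c (insert v \<tau>) = C.vsign v (insert v \<tau>) * c (insert v \<tau>)"
          by (simp add: C.vsign_def)
        also have "\<dots> = C.contr v c \<tau>" using True by (simp add: C.contr_def)
        finally show ?thesis .
      next
        case False
        have neg: "\<not> (v \<in> \<sigma> \<and> \<sigma> - {v} = \<tau>)" if "\<sigma> \<in> ?K" for \<sigma>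
          using False that by (auto simp: insert_absorb)
        have "(\<Sum>\<sigma>\<in>?K. if v \<in> \<sigma> \<and> \<sigma> - {v} = \<tau> then (-1) ^ card {u \<in> \<sigma>. (u, v) \<in> lex_order} * c \<sigma> else 0) = 0"
          by (intro sum.neutral ballI if_not_P neg)
        moreover have "C.contr v c \<tau> = 0"
          using False \<open>c \<in> C.chains ?K q'\<close> by (auto simp: C.contr_def C.chains_def)
        ultimately show ?thesis by simp
      qed
    qed simp
    finally show "boundary_map lex_order ?K c \<tau> = C.bdry c \<tau>"
      by (simp add: C.bdry_def sum_fun_apply)
  qed
  have cyc: "cycles lex_order ?K (int q - 1) = C.cyc ?K q"
    unfolding cycles_def C.cyc_def car zero_fun_def[symmetric] using bd by auto
  have "int q - 1 + 1 = int (Suc q) - 1" by simp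
  then have bnd: "boundaries lex_order ?K (int q - 1) = C.bnd ?K q"
    unfolding boundaries_def C.bnd_def by (simp only: car) (intro image_cong bd refl)
  let ?M = "(chain_space ?K (int q - 1))\<lparr>carrier := C.cyc ?K q\<rparr> :: ('f, (nat \<times> nat) set \<Rightarrow> 'f) module"
  interpret Q: chain_quotient "C.bnd ?K q" "C.cyc ?K q" ?M
  proof
    show "C.bnd ?K q \<subseteq> C.cyc ?K q" using C.bnd_subset_cyc[OF b] by (simp add: K)
  qed (simp_all add: C.subspace_bnd C.subspace_cyc chain_space_def fun_eq_iff cscale_def)
  have "C.hom_le ?K q N" using C.board_leD[OF assms b] by (simp add: K)
  then obtain S where S: "finite S" "card S \<le> N" "C.cyc ?K q \<subseteq> fs.span (C.bnd ?K q \<union> S)"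
    by (auto simp: C.hom_le_def)
  have "chessboard_betti TYPE('f) m n (int q - 1) \<le> card S"
    unfolding chessboard_betti_def reduced_homology_def cyc bnd by (rule Q.dim_Q_le[OF S(1,3)])
  then show ?thesis using S(2) by simp
qed

lemma chessboard_betti_hat_le:
  assumes "k + 2 \<le> b"
  shows "real (chessboard_betti_hat TYPE('f::field) k a b) \<le> poly2 (bound_poly k) (real a) (real b)"
proof -
  let ?m = "k + a + 3 * b - 1" and ?n = "k + 2 * a + 3 * b - 1" and ?q = "k + a + 2 * b - 1"
  interpret C: chain_operators "TYPE('f)" lex_order "{..<?m} \<times> {..<?n}"
    by (rule chain_operators_lex) simp
  obtain N where N: "C.param_le k a b N" "real N \<le> bound_base k (real a) (real b) ^ k / fact k"
    using C.param_le_bound[OF assms] by blast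
  have "int (k + a + 2 * b) - 2 = int ?q - 1" using assms by auto
  moreover have "chessboard_betti TYPE('f) ?m ?n (int ?q - 1) \<le> N"
    using N(1) unfolding C.param_le_def by (rule chessboard_betti_le)
  ultimately show ?thesis using N(2) by (simp add: chessboard_betti_hat_def poly2_bound_poly)
qed

theorem theorem4p11:
  shows "\<exists>f :: nat \<Rightarrow> real poly poly.
    (\<forall>k. total_degree (f k) = 3 * int k \<and>
      (\<forall>a b :: nat. b \<ge> k + 2 \<longrightarrow>
        real (chessboard_betti_hat TYPE('f::field) k a b) \<le> poly2 (f k) (real a) (real b)) \<and>
      (\<exists>\<epsilon>. total_degree \<epsilon> \<le> 3 * int k - 1 \<and>
        (\<forall>a b :: real. poly2 (f k) a b =
          1 / (3 ^ k * fact k) * ((a + 3 * b) ^ 3 - 9 * b ^ 3) ^ k + poly2 \<epsilon> a b))) \<and>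
    (\<forall>(m::nat) (n::nat) (d::int).
      m \<le> n \<longrightarrow> int n \<le> 2 * int m - 5 \<longrightarrow>
      (real m + real n - 4) / 3 \<le> real_of_int d \<longrightarrow>
      real_of_int d \<le> (2 * real m + real n - 7) / 4 \<longrightarrow>
      real (chessboard_betti TYPE('f) m n d) \<le>
        poly2 (f (nat (3 * d - int m - int n + 4)))
          (real n - real m) (real m - real_of_int d - 1))"
proof (intro exI[of _ bound_poly] conjI allI impI)
  fix k
  show "total_degree (bound_poly k) = 3 * int k" by (rule total_degree_bound_poly)
  show "real (chessboard_betti_hat TYPE('f) k a b) \<le> poly2 (bound_poly k) (real a) (real b)"
    if "b \<ge> k + 2" for a b
    using that by (rule chessboard_betti_hat_le)
  let ?\<epsilon> = "bound_poly k - const2 (1 / fact k) * lead_poly ^ k"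
  have "poly2 (bound_poly k) a b
      = 1 / (3 ^ k * fact k) * ((a + 3 * b) ^ 3 - 9 * b ^ 3) ^ k + poly2 ?\<epsilon> a b" for a b
    by (simp add: poly2_simps lead_poly_def power_divide)
  with bound_poly_remainder
  show "\<exists>\<epsilon>. total_degree \<epsilon> \<le> 3 * int k - 1 \<and> (\<forall>a b. poly2 (bound_poly k) a b =
      1 / (3 ^ k * fact k) * ((a + 3 * b) ^ 3 - 9 * b ^ 3) ^ k + poly2 \<epsilon> a b)"
    by blast
next
  fix m n :: nat and d :: int
  assume mn: "m \<le> n" "int n \<le> 2 * int m - 5"
    and d1: "(real m + real n - 4) / 3 \<le> real_of_int d"
    and d2: "real_of_int d \<le> (2 * real m + real n - 7) / 4"
  have "real_of_int (int m + int n - 4) \<le> real_of_int (3 * d)"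
    "real_of_int (4 * d) \<le> real_of_int (2 * int m + int n - 7)"
    using d1 d2 by simp_all
  then have d: "int m + int n - 4 \<le> 3 * d" "4 * d \<le> 2 * int m + int n - 7"
    by (simp_all only: of_int_le_iff)
  \<comment> \<open>The inverse of the parametrization in
    \<open>chessboard_betti_hat\<close>.\<close>
  define k a b where "k = nat (3 * d - int m - int n + 4)" and "a = n - m" and "b = nat (int m - d - 1)"
  have int_eqs: "int k = 3 * d - int m - int n + 4" "int a = int n - int m" "int b = int m - d - 1"
    using d mn by (auto simp: k_def a_def b_def)
  \<comment> \<open>\<open>b - k - 2 = 2 * m + n - 7 - 4 * d\<close>, so the upper bound on
    \<open>d\<close> amounts to \<open>b \<ge> k + 2\<close>, as the lower one amounts to
    \<open>k \<ge> 0\<close>.\<close>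
  have "k + 2 \<le> b" "k + a + 3 * b - 1 = m" "k + 2 * a + 3 * b - 1 = n" "int (k + a + 2 * b) - 2 = d"
    using int_eqs d mn by linarith+
  then have "chessboard_betti TYPE('f) m n d = chessboard_betti_hat TYPE('f) k a b"
    by (simp add: chessboard_betti_hat_def)
  moreover have "real a = real n - real m" "real b = real m - real_of_int d - 1"
    using int_eqs by linarith+
  ultimately show "real (chessboard_betti TYPE('f) m n d) \<le>
      poly2 (bound_poly (nat (3 * d - int m - int n + 4)))
        (real n - real m) (real m - real_of_int d - 1)"
    using chessboard_betti_hat_le[OF \<open>k + 2 \<le> b\<close>, where 'f = 'f and a = a] by (simp add: k_def)
qed

end
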